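(* Let $n\ge 2$, let $Y$ be a $d$-dimensional connected real analytic submanifold of $\mathbb R^n\cong M_{n,1}(\mathbb R)$ with $d\ge 2$, and let $\{R_\ell\}$ be a countable collection of proper closed analytic submanifolds of $Y$. Suppose $f:\mathbb R_{>0}\to\mathbb R_{>0}$ is continuous and non-increasing and satisfies $t^{\frac{1}{n-d+1}}f(t)\to\infty$ monotonically as $t\to\infty$. Then $Y\cap\operatorname{UA}_{n,1}(f)\smallsetminus\bigcup_{\ell\in\mathbb N}R_\ell$ is uncountable and dense in $Y$. In particular, if in addition $Y$ is not contained in any proper rational affine subspace of $\mathbb R^n$, then $Y\cap\operatorname{UA}^*_{n,1}(f)$ is uncountable and dense in $Y$.
   Context: Vectors in $\mathbb R^n$ are viewed as column vectors. $\operatorname{UA}_{n,1}(f)$ is the set of $\mathbf{x}\in\mathbb R^n$ such that for every sufficiently large $t>0$ there exist $q\in\mathbb Z\smallsetminus\{0\}$ and $\mathbf{p}\in\mathbb Z^n$ with $|q|\le t$ and $\|q\mathbf{x}-\mathbf{p}\|\le f(t)$ (sup norm). $\operatorname{UA}^*_{n,1}(f)$ is the set of elements of $\operatorname{UA}_{n,1}(f)$ not contained in any proper rational affine subspace of $\mathbb R^n$. *)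

theory Defs
  imports "HOL-Analysis.Analysis"
begin

text \<open>The coefficients are indexed by multi-indices \<open>\<alpha> :: 'm \<Rightarrow> nat\<close>; the convergence expressed by
  \<open>has_sum\<close> is unconditional, hence absolute. Since \<open>U\<close> is open, whether the ball is required
  to lie in \<open>U\<close> makes no difference.\<close>

definition real_analytic_on ::
    "(real ^ 'm::finite \<Rightarrow> real ^ 'n::finite) \<Rightarrow> (real ^ 'm) set \<Rightarrow> bool" where
  "real_analytic_on f U \<longleftrightarrow> open U \<and>
     (\<forall>x\<in>U. \<exists>r>0. \<exists>c :: ('m \<Rightarrow> nat) \<Rightarrow> real ^ 'n. \<forall>y\<in>ball x r.
        ((\<lambda>\<alpha>. (\<Prod>i\<in>UNIV. (y $ i - x $ i) ^ \<alpha> i) *\<^sub>R c \<alpha>) has_sum f y) UNIV)"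

text \<open>Embedded submanifolds without boundary, given by analytic slice charts of the ambient space. Any
  \<open>d\<close>-dimensional linear subspace \<open>L\<close> may serve as the slice. The empty set is a submanifold of
  every dimension.\<close>

definition analytic_submanifold :: "nat \<Rightarrow> (real ^ 'n::finite) set \<Rightarrow> bool" where
  "analytic_submanifold d Y \<longleftrightarrow>
     (\<forall>y\<in>Y. \<exists>U (V :: (real ^ 'n) set) \<phi> \<psi> L.
        y \<in> U \<and> homeomorphism U V \<phi> \<psi> \<and>
        real_analytic_on \<phi> U \<and> real_analytic_on \<psi> V \<and>
        subspace L \<and> dim L = d \<and> \<phi> ` (U \<inter> Y) = V \<inter> L)"

text \<open>\<open>R\<close> is closed as a subset of \<open>Y\<close>, not necessarily in the ambient space. For \<open>R \<subseteq> Y\<close>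
  it makes no difference whether the charts are taken in \<open>Y\<close> or in the ambient space.\<close>

definition proper_closed_analytic_submanifold_of ::
    "(real ^ 'n::finite) set \<Rightarrow> (real ^ 'n) set \<Rightarrow> bool" where
  "proper_closed_analytic_submanifold_of R Y \<longleftrightarrow>
     R \<subset> Y \<and> closedin (top_of_set Y) R \<and> (\<exists>k. analytic_submanifold k R)"

definition rational_affine_subspace :: "(real ^ 'n::finite) set \<Rightarrow> bool" where
  "rational_affine_subspace A \<longleftrightarrow> (\<exists>S. (\<forall>x\<in>S. \<forall>i. x $ i \<in> \<rat>) \<and> A = affine hull S)"

definition UA :: "(real \<Rightarrow> real) \<Rightarrow> (real ^ 'n::finite) set" where
  "UA f = {x. \<forall>\<^sub>F t in at_top. \<exists>(q::int) (p :: int ^ 'n).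
      q \<noteq> 0 \<and> real_of_int \<bar>q\<bar> \<le> t \<and>
      infnorm (real_of_int q *\<^sub>R x - (\<chi> i. real_of_int (p $ i))) \<le> f t}"

definition UA_star :: "(real \<Rightarrow> real) \<Rightarrow> (real ^ 'n::finite) set" where
  "UA_star f = {x \<in> UA f. \<forall>A. rational_affine_subspace A \<and> A \<noteq> UNIV \<longrightarrow> x \<notin> A}"

end

theory Submission
  imports Defs
begin

text \<open>Near any of its points \<open>Y\<close> is the graph of a Lipschitz map \<open>g\<close> over an open subset of a coordinate
  \<open>d\<close>-plane. Over a rational line in this plane the points of \<open>Y\<close> lie in a rational affine subspace of
  dimension \<open>n - d + 1\<close>, so Dirichlet's theorem approximates them at the rate \<open>t powr - (1 / (n - d + 1))\<close>, which
  is eventually below \<open>f t / 2\<close>; by continuity, nearby points of \<open>Y\<close> are approximated equally well for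
  \<open>t\<close> in any given bounded range. Moving alternately along a rational line and changing to another
  rational line at a rational point, with rapidly shrinking steps, produces a limit in \<open>UA f\<close>.

  At each step one forbidden set is left for good. This requires a rational direction in which the forbidden
  set is left immediately, and it exists as soon as some tangent vector of \<open>Y\<close> lies outside the contingent
  cone of the forbidden set. For a submanifold of smaller dimension this is clear from the tangent spaces;
  a submanifold of full dimension is open in \<open>Y\<close> and hence excluded by connectedness. For a hyperplane
  one takes a vector at which the lowest-order homogeneous part of the pulled back equation does not
  vanish; that part exists by the identity theorem.\<close>

section \<open>Homogeneous expansions of analytic maps\<close>

text \<open>Since \<open>Y\<close> is curved, the points over a rational line do not form a line.
  Only the coordinates in the plane are prescribed; the position on the line and the n - d other
  coordinates stay free, and these are the n - d + 1 numbers to be approximated simultaneously.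

  The time after which Dirichlet's bound beats \<open>f t / 2\<close> depends on the line, but not
  on the point over it. So a direction and its threshold are fixed first and the length of the move
  afterwards. Until the new threshold is reached, the corner point, which lies on both lines, is
  still served by the old line, and the factor 1/2 pays for the displacement.

  Why a tangent vector outside the contingent cone suffices: the complement of that cone is open,
  and \<open>Y\<close> is a Lipschitz graph, so the projected vector may be perturbed to a rational
  one. Uncountability follows from the same construction: a countable set of solutions could be
  forbidden point by point.\<close>

lemma summable_on_imp_norm_summable_on_cart:
  fixes g :: "'a \<Rightarrow> real ^ 'n::finite"
  assumes "g summable_on S"
  shows "(\<lambda>x. norm (g x)) summable_on S"
proof -
  have "(\<lambda>x. g x $ k) summable_on S" for k
    using summable_on_bounded_linear[OF bounded_linear_vec_nth assms] by (simp add: o_def)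
  then have *: "(\<lambda>x. \<bar>g x $ k\<bar>) summable_on S" for k
    using summable_on_iff_abs_summable_on_real by fastforce
  have "(\<lambda>x. \<Sum>k\<in>J. \<bar>g x $ k\<bar>) summable_on S" if "finite J" for J
    using that by (induction J rule: finite_induct) (auto intro!: summable_on_add *)
  then have "(\<lambda>x. \<Sum>k\<in>UNIV. \<bar>g x $ k\<bar>) summable_on S" by simp
  then show ?thesis
    by (rule Infinite_Sum.abs_summable_on_comparison_test') (rule norm_le_l1_cart)
qed

text \<open>A power series in several variables regrouped by degree, so that multi-indices can be
  forgotten. The last clause plays the part of a derivative bound, hence the power lower by one; it
  is stated for \<open>Suc j\<close> because homogeneity makes degree 0 constant.\<close>

definition homogeneous_series ::
    "(nat \<Rightarrow> 'a::real_normed_vector \<Rightarrow> 'b::real_normed_vector) \<Rightarrow> real \<Rightarrow> real \<Rightarrow> bool" where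
  "homogeneous_series q M K \<longleftrightarrow> M > 0 \<and> K > 0 \<and> linear (q 1) \<and>
     (\<forall>j t w. q j (t *\<^sub>R w) = t ^ j *\<^sub>R q j w) \<and>
     (\<forall>j w. norm (q j w) \<le> M * (K * norm w) ^ j) \<and>
     (\<forall>j \<rho> w w'. norm w \<le> \<rho> \<longrightarrow> norm w' \<le> \<rho> \<longrightarrow>
        norm (q (Suc j) w - q (Suc j) w') \<le> M * (K * \<rho>) ^ j * norm (w - w'))"

section \<open>Monomials: homogeneity and Lipschitz bounds\<close>

definition monom_fun :: "('m::finite \<Rightarrow> nat) \<Rightarrow> real ^ 'm \<Rightarrow> real" where
  "monom_fun \<alpha> w = (\<Prod>i\<in>UNIV. (w $ i) ^ \<alpha> i)"

lemma monom_fun_scaleR: "monom_fun \<alpha> (t *\<^sub>R w) = t ^ sum \<alpha> UNIV * monom_fun \<alpha> w"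
  by (simp add: monom_fun_def power_mult_distrib prod.distrib power_sum)

lemma abs_monom_fun_le: "\<bar>monom_fun \<alpha> w\<bar> \<le> norm w ^ sum \<alpha> UNIV"
proof -
  have "\<bar>monom_fun \<alpha> w\<bar> = (\<Prod>i\<in>UNIV. \<bar>w $ i\<bar> ^ \<alpha> i)"
    by (simp add: monom_fun_def abs_prod power_abs)
  also have "\<dots> \<le> (\<Prod>i\<in>UNIV. norm w ^ \<alpha> i)"
    by (intro prod_mono) (auto intro!: power_mono component_le_norm_cart)
  finally show ?thesis by (simp add: power_sum)
qed

lemma abs_monom_fun_diff_le_unit:
  assumes "norm z \<le> 1" "norm z' \<le> 1"
  shows "\<bar>monom_fun \<alpha> z - monom_fun \<alpha> z'\<bar> \<le> real (sum \<alpha> UNIV) * norm (z - z')"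
proof -
  have le1: "\<bar>z $ i\<bar> \<le> 1" "\<bar>z' $ i\<bar> \<le> 1" for i
    using assms component_le_norm_cart order_trans by blast+
  have "\<bar>monom_fun \<alpha> z - monom_fun \<alpha> z'\<bar> \<le> (\<Sum>i\<in>UNIV. \<bar>(z $ i) ^ \<alpha> i - (z' $ i) ^ \<alpha> i\<bar>)"
    unfolding monom_fun_def
    using norm_prod_diff[of UNIV "\<lambda>i. (z $ i) ^ \<alpha> i" "\<lambda>i. (z' $ i) ^ \<alpha> i"] le1
    by (simp add: power_abs power_le_one)
  also have "\<dots> \<le> (\<Sum>i\<in>UNIV. real (\<alpha> i) * norm (z - z'))"
  proof (rule sum_mono)
    fix i
    have "\<bar>(z $ i) ^ \<alpha> i - (z' $ i) ^ \<alpha> i\<bar> \<le> real (\<alpha> i) * \<bar>z $ i - z' $ i\<bar>"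
      using norm_power_diff[of "z $ i" "z' $ i" "\<alpha> i"] le1 by simp
    also have "\<dots> \<le> real (\<alpha> i) * norm (z - z')"
      using component_le_norm_cart[of "z - z'" i] by (intro mult_left_mono) auto
    finally show "\<bar>(z $ i) ^ \<alpha> i - (z' $ i) ^ \<alpha> i\<bar> \<le> real (\<alpha> i) * norm (z - z')" .
  qed
  finally show ?thesis by (simp add: sum_distrib_right)
qed

text \<open>By homogeneity both points are scaled into the unit ball, where all factors have modulus
  at most 1 and the difference of products telescopes.\<close>

lemma abs_monom_fun_diff_le:
  assumes "norm w \<le> \<rho>" "norm w' \<le> \<rho>" "sum \<alpha> UNIV = Suc j"
  shows "\<bar>monom_fun \<alpha> w - monom_fun \<alpha> w'\<bar> \<le> \<rho> ^ j * real (Suc j) * norm (w - w')"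
proof (cases "\<rho> = 0")
  case True
  then show ?thesis using assms by simp
next
  case False
  then have \<rho>: "\<rho> > 0" using assms norm_ge_zero[of w] by linarith
  define z z' where "z = (1/\<rho>) *\<^sub>R w" and "z' = (1/\<rho>) *\<^sub>R w'"
  have w: "w = \<rho> *\<^sub>R z" "w' = \<rho> *\<^sub>R z'" using \<rho> by (auto simp: z_def z'_def)
  have zn: "norm z \<le> 1" "norm z' \<le> 1" using assms \<rho> by (auto simp: z_def z'_def field_simps)
  have "\<bar>monom_fun \<alpha> w - monom_fun \<alpha> w'\<bar> = \<rho> ^ Suc j * \<bar>monom_fun \<alpha> z - monom_fun \<alpha> z'\<bar>"
    unfolding w monom_fun_scaleR assms(3)
    using \<rho> by (simp add: abs_mult flip: right_diff_distrib)
  also have "\<dots> \<le> \<rho> ^ Suc j * (real (Suc j) * norm (z - z'))"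
    using abs_monom_fun_diff_le_unit[OF zn, of \<alpha>] assms(3) \<rho> by (intro mult_left_mono) auto
  also have "norm (z - z') = norm (w - w') / \<rho>"
    using \<rho> unfolding w by (simp flip: scaleR_right_diff_distrib)
  also have "\<rho> ^ Suc j * (real (Suc j) * (norm (w - w') / \<rho>)) = \<rho> ^ j * real (Suc j) * norm (w - w')"
    using \<rho> by simp
  finally show ?thesis .
qed

lemma linear_monom_fun_1:
  assumes "sum \<alpha> UNIV = 1"
  shows "linear (monom_fun \<alpha>)"
proof -
  obtain k where k: "\<alpha> k = 1" "\<And>b. b \<noteq> k \<Longrightarrow> \<alpha> b = 0"
    using assms sum_eq_1_iff[of UNIV \<alpha>] by auto
  have "monom_fun \<alpha> w = w $ k" for w
  proof -
    have "monom_fun \<alpha> w = (\<Prod>i\<in>UNIV. if i = k then w $ i else 1)"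
      unfolding monom_fun_def by (intro prod.cong) (auto simp: k)
    then show ?thesis by simp
  qed
  then show ?thesis by (auto intro!: linearI)
qed

lemma Suc_le_two_power: "Suc j \<le> 2 ^ j"
  by (induction j) auto

text \<open>Unconditional convergence is absolute in finite dimension. So convergence at one point
  with equal positive coordinates \<open>r1\<close> bounds the sum of all coefficient norms weighted
  by powers of \<open>r1\<close>, which gives Cauchy type bounds degree by degree.\<close>

lemma real_analytic_on_expansion:
  fixes f :: "real ^ 'm::finite \<Rightarrow> real ^ 'n::finite"
  assumes "real_analytic_on f U" "x \<in> U"
  obtains r q M K where "r > 0" "ball x r \<subseteq> U" "homogeneous_series q M K"
    "\<And>w. norm w < r \<Longrightarrow> (\<lambda>j. q j w) sums f (x + w)"
proof -
  from assms obtain r0 c where r0: "r0 > 0" and hs: "\<And>y. y \<in> ball x r0 \<Longrightarrow>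
       ((\<lambda>\<alpha>. (\<Prod>i\<in>UNIV. (y $ i - x $ i) ^ \<alpha> i) *\<^sub>R c \<alpha>) has_sum f y) UNIV"
    unfolding real_analytic_on_def by blast
  obtain r2 where r2: "r2 > 0" "ball x r2 \<subseteq> U"
    using assms unfolding real_analytic_on_def by (meson open_contains_ball)
  define r where "r = min r0 r2"
  have r: "r > 0" "ball x r \<subseteq> U" "ball x r \<subseteq> ball x r0" using r0 r2 by (auto simp: r_def)
  have expand: "((\<lambda>\<alpha>. monom_fun \<alpha> w *\<^sub>R c \<alpha>) has_sum f (x + w)) UNIV" if "norm w < r0" for w
    using hs[of "x + w"] that by (simp add: monom_fun_def dist_norm)
  \<comment> \<open>The point \<open>w1\<close> with all coordinates \<open>r1\<close> then has
    l1-norm \<open>r0 / 2\<close> and lies in the ball of convergence.\<close>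
  define r1 where "r1 = r0 / (2 * CARD('m))"
  have r1: "r1 > 0" using r0 by (simp add: r1_def)
  define w1 :: "real ^ 'm" where "w1 = (\<chi> i. r1)"
  have "norm w1 \<le> (\<Sum>i\<in>(UNIV::'m set). \<bar>w1 $ i\<bar>)" by (rule norm_le_l1_cart)
  also have "\<dots> = r0 / 2" using r1 by (simp add: w1_def) (simp add: r1_def)
  finally have "norm w1 < r0" using r0 by simp
  then have "(\<lambda>\<alpha>. monom_fun \<alpha> w1 *\<^sub>R c \<alpha>) summable_on UNIV"
    using expand has_sum_imp_summable by blast
  then have "(\<lambda>\<alpha>. norm (monom_fun \<alpha> w1 *\<^sub>R c \<alpha>)) summable_on UNIV"
    by (rule summable_on_imp_norm_summable_on_cart)
  moreover have "norm (monom_fun \<alpha> w1 *\<^sub>R c \<alpha>) = r1 ^ sum \<alpha> UNIV * norm (c \<alpha>)" for \<alpha>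
    using r1 by (simp add: monom_fun_def w1_def power_sum abs_prod)
  ultimately have summ: "(\<lambda>\<alpha>. r1 ^ sum \<alpha> UNIV * norm (c \<alpha>)) summable_on UNIV"
    by (simp only:)
  define M0 where "M0 = (\<Sum>\<^sub>\<infinity>\<alpha>. r1 ^ sum \<alpha> UNIV * norm (c \<alpha>))"
  have M0: "M0 \<ge> 0" unfolding M0_def using r1 by (intro infsum_nonneg) auto
  define A where "A j = {\<alpha>::'m \<Rightarrow> nat. sum \<alpha> UNIV = j}" for j
  have finA: "finite (A j)" for j
  proof (rule finite_subset)
    show "A j \<subseteq> {f. \<forall>x. (x \<in> (UNIV::'m set) \<longrightarrow> f x \<in> {..j}) \<and> (x \<notin> (UNIV::'m set) \<longrightarrow> f x = 0)}"
      by (auto simp: A_def intro: member_le_sum)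
    show "finite \<dots>" by (rule finite_set_of_finite_funs) auto
  qed
  have cA: "(\<Sum>\<alpha>\<in>A j. norm (c \<alpha>)) \<le> M0 / r1 ^ j" for j
  proof -
    have "r1 ^ j * (\<Sum>\<alpha>\<in>A j. norm (c \<alpha>)) = (\<Sum>\<alpha>\<in>A j. r1 ^ sum \<alpha> UNIV * norm (c \<alpha>))"
      unfolding sum_distrib_left by (intro sum.cong) (auto simp: A_def)
    also have "\<dots> \<le> M0" unfolding M0_def
      using r1 by (intro finite_sum_le_infsum summ finA) auto
    finally show ?thesis using r1 by (simp add: field_simps)
  qed
  define q where "q j w = (\<Sum>\<alpha>\<in>A j. monom_fun \<alpha> w *\<^sub>R c \<alpha>)" for j w
  \<comment> \<open>The 2 in \<open>K\<close> absorbs the degree factor of the Lipschitz bound, as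
    \<open>Suc j \<le> 2 ^ j\<close>. \<open>M\<close> has to dominate \<open>M0\<close> for values
    and \<open>M0 / r1\<close> for differences, where one power of \<open>r1\<close> is left over;
    the 1 keeps it positive.\<close>
  define K M where "K = 2 / r1" and "M = M0 + M0 / r1 + 1"
  have KM: "K > 0" "M > 0" "M \<ge> M0" "M \<ge> M0 / r1" using r1 M0 by (auto simp: K_def M_def add_nonneg_pos)
  have lin: "linear (q 1)"
    unfolding q_def using linear_monom_fun_1
    by (intro linear_compose_sum ballI bounded_linear.linear
         bounded_linear_scaleR_const[THEN bounded_linear_compose])
       (auto simp: A_def linear_conv_bounded_linear)
  have hom: "q j (t *\<^sub>R w) = t ^ j *\<^sub>R q j w" for j t w
    unfolding q_def scaleR_sum_right by (intro sum.cong) (auto simp: A_def monom_fun_scaleR)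
  have bd: "norm (q j w) \<le> M * (K * norm w) ^ j" for j w
  proof -
    have "norm (q j w) \<le> (\<Sum>\<alpha>\<in>A j. norm w ^ j * norm (c \<alpha>))"
      unfolding q_def
    proof (rule sum_norm_le)
      fix \<alpha> assume "\<alpha> \<in> A j"
      then have "\<bar>monom_fun \<alpha> w\<bar> \<le> norm w ^ j" using abs_monom_fun_le[of \<alpha> w] by (simp add: A_def)
      then show "norm (monom_fun \<alpha> w *\<^sub>R c \<alpha>) \<le> norm w ^ j * norm (c \<alpha>)"
        by (simp add: mult_right_mono)
    qed
    also have "\<dots> = norm w ^ j * (\<Sum>\<alpha>\<in>A j. norm (c \<alpha>))" by (simp add: sum_distrib_left)
    also have "\<dots> \<le> norm w ^ j * (M0 / r1 ^ j)" by (intro mult_left_mono cA) auto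
    also have "\<dots> = M0 * (norm w / r1) ^ j" by (simp add: power_divide)
    also have "\<dots> \<le> M * (K * norm w) ^ j"
      using KM M0 r1 by (intro mult_mono power_mono) (auto simp: K_def field_simps)
    finally show ?thesis .
  qed
  have df: "norm (q (Suc j) w - q (Suc j) w') \<le> M * (K * \<rho>) ^ j * norm (w - w')"
    if \<rho>: "norm w \<le> \<rho>" "norm w' \<le> \<rho>" for j \<rho> w w'
  proof -
    have \<rho>0: "\<rho> \<ge> 0" using \<rho> norm_ge_zero[of w] by linarith
    have "norm (q (Suc j) w - q (Suc j) w')
        \<le> (\<Sum>\<alpha>\<in>A (Suc j). \<rho> ^ j * real (Suc j) * norm (w - w') * norm (c \<alpha>))"
      unfolding q_def sum_subtractf[symmetric] scaleR_left_diff_distrib[symmetric]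
    proof (rule sum_norm_le)
      fix \<alpha> assume "\<alpha> \<in> A (Suc j)"
      then show "norm ((monom_fun \<alpha> w - monom_fun \<alpha> w') *\<^sub>R c \<alpha>)
          \<le> \<rho> ^ j * real (Suc j) * norm (w - w') * norm (c \<alpha>)"
        using abs_monom_fun_diff_le[OF \<rho>, of \<alpha> j] by (simp add: A_def mult_right_mono)
    qed
    also have "\<dots> = \<rho> ^ j * real (Suc j) * norm (w - w') * (\<Sum>\<alpha>\<in>A (Suc j). norm (c \<alpha>))"
      by (simp add: sum_distrib_left)
    also have "\<dots> \<le> \<rho> ^ j * 2 ^ j * norm (w - w') * (M0 / r1 ^ Suc j)"
    proof -
      have "real (Suc j) \<le> 2 ^ j" using Suc_le_two_power[of j] by (metis of_nat_le_iff of_nat_numeral of_nat_power)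
      then show ?thesis
        using cA[of "Suc j"] \<rho>0 by (intro mult_mono) (auto intro!: sum_nonneg)
    qed
    also have "\<dots> = (M0 / r1) * (K * \<rho>) ^ j * norm (w - w')"
      using r1 by (simp add: K_def field_simps)
    also have "\<dots> \<le> M * (K * \<rho>) ^ j * norm (w - w')"
      using KM \<rho>0 by (intro mult_right_mono) auto
    finally show ?thesis .
  qed
  have sums: "(\<lambda>j. q j w) sums f (x + w)" if "norm w < r" for w
  proof -
    have "((\<lambda>\<alpha>. monom_fun \<alpha> w *\<^sub>R c \<alpha>) has_sum f (x + w)) UNIV"
      using that by (intro expand) (simp add: r_def)
    \<comment> \<open>Each multi-index has exactly one degree, so grouping by degree is a
      reindexing.\<close>
    moreover have "bij_betw snd (Sigma UNIV A) UNIV"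
      by (rule bij_betwI[where g = "\<lambda>\<alpha>. (sum \<alpha> UNIV, \<alpha>)"]) (auto simp: A_def)
    ultimately have "((\<lambda>p. monom_fun (snd p) w *\<^sub>R c (snd p)) has_sum f (x + w)) (Sigma UNIV A)"
      using has_sum_reindex_bij_betw[of snd "Sigma UNIV A" UNIV "\<lambda>\<alpha>. monom_fun \<alpha> w *\<^sub>R c \<alpha>"] by simp
    then have "((\<lambda>j. q j w) has_sum f (x + w)) UNIV"
      unfolding q_def by (rule has_sum_SigmaD) (simp add: finA has_sum_finite)
    then show ?thesis by (rule has_sum_imp_sums)
  qed
  have "homogeneous_series q M K"
    unfolding homogeneous_series_def using KM lin hom bd df by blast
  then show thesis using that r sums by blast
qed

section \<open>Vanishing of homogeneous series\<close>

lemma homogeneous_seriesD: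
  assumes "homogeneous_series q M K"
  shows "M > 0" "K > 0" "linear (q 1)"
    "q j (t *\<^sub>R w) = t ^ j *\<^sub>R q j w"
    "norm (q j w) \<le> M * (K * norm w) ^ j"
    "norm w \<le> \<rho> \<Longrightarrow> norm w' \<le> \<rho> \<Longrightarrow>
        norm (q (Suc j) w - q (Suc j) w') \<le> M * (K * \<rho>) ^ j * norm (w - w')"
  using assms unfolding homogeneous_series_def by blast+

lemma homogeneous_series_0:
  assumes "homogeneous_series q M K"
  shows "q 0 w = q 0 0"
  using homogeneous_seriesD(4)[OF assms, of 0 0 w] by simp

lemma homogeneous_series_continuous:
  assumes "homogeneous_series q M K"
  shows "isCont (q j) w"
proof (cases j)
  case 0
  have "q j = (\<lambda>_. q 0 0)" using homogeneous_series_0[OF assms] 0 by auto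
  then show ?thesis by (metis continuous_const)
next
  case (Suc i)
  define \<rho> where "\<rho> = norm w + 1"
  have \<rho>: "\<rho> \<ge> 0" "norm w < \<rho>" by (auto simp: \<rho>_def add_nonneg_nonneg)
  have "(M * (K * \<rho>) ^ i)-lipschitz_on (ball 0 \<rho>) (q j)"
    unfolding Suc
  proof (rule lipschitz_onI)
    show "dist (q (Suc i) x) (q (Suc i) y) \<le> M * (K * \<rho>) ^ i * dist x y"
      if "x \<in> ball 0 \<rho>" "y \<in> ball 0 \<rho>" for x y
      using homogeneous_seriesD(6)[OF assms, of x \<rho> y i] that by (simp add: dist_norm)
    show "0 \<le> M * (K * \<rho>) ^ i"
      using \<rho> homogeneous_seriesD(1,2)[OF assms] by simp
  qed
  then have "continuous_on (ball 0 \<rho>) (q j)" by (rule lipschitz_on_continuous_on)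
  then show ?thesis using \<rho> by (simp add: continuous_on_eq_continuous_at)
qed

text \<open>Turns the expansion of an inverse chart into that of a hyperplane equation pulled back
  by it.\<close>

lemma homogeneous_series_inner:
  fixes q :: "nat \<Rightarrow> 'a::real_normed_vector \<Rightarrow> 'b::euclidean_space"
  assumes "homogeneous_series q M K"
  shows "homogeneous_series (\<lambda>j w. a \<bullet> q j w - (if j = 0 then c else 0)) (norm a * M + \<bar>c\<bar> + M) K"
proof -
  note h = homogeneous_seriesD[OF assms]
  let ?M = "norm a * M + \<bar>c\<bar> + M"
  have M: "?M > 0" using h(1) by (intro add_nonneg_pos) auto
  have le: "norm a * M \<le> ?M" using h(1) by simp
  have lin: "linear (\<lambda>w. a \<bullet> q 1 w - (if (1::nat) = 0 then c else 0))"
    using h(3) by (auto intro!: linearI simp: linear_add linear_scale inner_add_right)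
  have hom: "a \<bullet> q j (t *\<^sub>R w) - (if j = 0 then c else 0) = t ^ j *\<^sub>R (a \<bullet> q j w - (if j = 0 then c else 0))" for j t w
    by (cases j) (simp_all add: h(4))
  have bd: "norm (a \<bullet> q j w - (if j = 0 then c else 0)) \<le> ?M * (K * norm w) ^ j" for j w
  proof -
    have "\<bar>a \<bullet> q j w\<bar> \<le> norm a * (M * (K * norm w) ^ j)"
      using Cauchy_Schwarz_ineq2 h(5) by (meson mult_left_mono norm_ge_zero order_trans)
    moreover have "norm a * (M * (K * norm w) ^ j) + (if j = 0 then \<bar>c\<bar> else 0) \<le> ?M * (K * norm w) ^ j"
      using h(1,2) by (cases "j = 0") (auto simp: algebra_simps)
    ultimately show ?thesis by (auto split: if_splits)
  qed
  have df: "norm (a \<bullet> q (Suc j) w - a \<bullet> q (Suc j) w') \<le> ?M * (K * \<rho>) ^ j * norm (w - w')"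
    if "norm w \<le> \<rho>" "norm w' \<le> \<rho>" for j w w' \<rho>
  proof -
    have \<rho>: "0 \<le> \<rho>" using that(1) norm_ge_zero order_trans by blast
    have "\<bar>a \<bullet> q (Suc j) w - a \<bullet> q (Suc j) w'\<bar> \<le> norm a * (M * (K * \<rho>) ^ j * norm (w - w'))"
      unfolding inner_diff_right[symmetric]
      using Cauchy_Schwarz_ineq2 h(6)[OF that] by (meson mult_left_mono norm_ge_zero order_trans)
    also have "\<dots> = norm a * M * ((K * \<rho>) ^ j * norm (w - w'))" by simp
    also have "\<dots> \<le> ?M * ((K * \<rho>) ^ j * norm (w - w'))"
      using le h(2) \<rho> by (intro mult_right_mono) auto
    finally show ?thesis by simp
  qed
  show ?thesis
    unfolding homogeneous_series_def using M h(2) lin hom bd df by auto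
qed

text \<open>The term of degree \<open>j\<close> is minus the tail behind it, and that tail is
  dominated by a geometric series of ratio at most 1/2, whence the factor 2.\<close>

lemma homogeneous_series_tail_le:
  fixes q :: "nat \<Rightarrow> 'a::real_normed_vector \<Rightarrow> 'b::banach"
  assumes "homogeneous_series q M K" "(\<lambda>j. q j w) sums 0" "\<And>i. i < j \<Longrightarrow> q i w = 0"
    and "K * norm w \<le> 1 / 2"
  shows "norm (q j w) \<le> 2 * M * (K * norm w) ^ Suc j"
proof -
  define \<kappa> where "\<kappa> = K * norm w"
  note h = homogeneous_seriesD[OF assms(1)]
  have \<kappa>: "0 \<le> \<kappa>" "\<kappa> \<le> 1 / 2" using h(2) assms(4) by (auto simp: \<kappa>_def)
  have "(\<lambda>i. q (i + Suc j) w) sums (0 - (\<Sum>i<Suc j. q i w))"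
    using assms(2) by (rule sums_split_initial_segment)
  then have tail: "(\<lambda>i. q (i + Suc j) w) sums (- q j w)" using assms(3) by simp
  have geo: "(\<lambda>i. M * \<kappa> ^ Suc j * \<kappa> ^ i) sums (M * \<kappa> ^ Suc j * (1 / (1 - \<kappa>)))"
    using \<kappa> by (intro sums_mult geometric_sums) simp
  have "norm (- q j w) \<le> M * \<kappa> ^ Suc j * (1 / (1 - \<kappa>))"
    using norm_suminf_le[of "\<lambda>i. q (i + Suc j) w" "\<lambda>i. M * \<kappa> ^ Suc j * \<kappa> ^ i"]
      h(5)[of "_ + Suc j" w] sums_unique[OF tail] sums_unique[OF geo] sums_summable[OF geo]
    by (simp add: \<kappa>_def power_add mult_ac)
  also have "\<dots> \<le> M * \<kappa> ^ Suc j * 2"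
    using \<kappa> h(1) by (intro mult_left_mono) (auto simp: field_simps)
  finally show ?thesis by (simp add: \<kappa>_def mult_ac)
qed

text \<open>Isolation of zeros along a ray. The term of degree \<open>j\<close> scales with the
  \<open>j\<close>-th power of \<open>\<tau>\<close>, while the tail that cancels it at a zero has
  one more power; letting the zeros tend to 0 kills one degree after the other.\<close>

lemma homogeneous_series_vanish_ray:
  fixes q :: "nat \<Rightarrow> 'a::real_normed_vector \<Rightarrow> 'b::banach"
  assumes hs: "homogeneous_series q M K"
    and zeros: "\<And>e. e > 0 \<Longrightarrow> \<exists>\<tau>. \<tau> \<noteq> 0 \<and> \<bar>\<tau>\<bar> < e \<and> (\<lambda>j. q j (\<tau> *\<^sub>R v)) sums 0"
  shows "q j v = 0"
proof (induction j rule: less_induct)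
  case (less j)
  note h = homogeneous_seriesD[OF hs]
  show ?case
  proof (rule ccontr)
    assume ne: "q j v \<noteq> 0"
    define C where "C = 2 * M * (K * norm v) ^ Suc j + 1"
    have C: "C > 0" using h(1,2) by (auto simp: C_def add_nonneg_pos)
    \<comment> \<open>The first bound produces the contradiction, the second keeps the ratio in the
      tail estimate at most 1/2.\<close>
    define e where "e = min (norm (q j v) / C) (1 / (2 * K * (norm v + 1)))"
    have e: "e > 0" using ne C h(2) by (auto simp: e_def intro!: divide_pos_pos mult_pos_pos add_nonneg_pos)
    then obtain \<tau> where \<tau>: "\<tau> \<noteq> 0" "\<bar>\<tau>\<bar> < e" "(\<lambda>j. q j (\<tau> *\<^sub>R v)) sums 0"
      using zeros by blast
    have "\<bar>\<tau>\<bar> * (2 * K * (norm v + 1)) \<le> 1"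
      using \<tau>(2) h(2) by (auto simp: e_def pos_less_divide_eq add_nonneg_pos)
    moreover have "\<bar>\<tau>\<bar> * (2 * K * norm v) \<le> \<bar>\<tau>\<bar> * (2 * K * (norm v + 1))"
      using h(2) by (intro mult_left_mono) auto
    ultimately have "K * norm (\<tau> *\<^sub>R v) \<le> 1 / 2" by (simp add: mult_ac)
    then have "norm (q j (\<tau> *\<^sub>R v)) \<le> 2 * M * (K * norm (\<tau> *\<^sub>R v)) ^ Suc j"
      using less \<tau>(3) h(4) by (intro homogeneous_series_tail_le[OF hs]) auto
    then have "\<bar>\<tau>\<bar> ^ j * norm (q j v) \<le> \<bar>\<tau>\<bar> ^ j * (\<bar>\<tau>\<bar> * (2 * M * (K * norm v) ^ Suc j))"
      by (simp add: h(4) power_abs power_mult_distrib mult_ac)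
    then have "norm (q j v) \<le> \<bar>\<tau>\<bar> * (2 * M * (K * norm v) ^ Suc j)"
      using \<tau>(1) by simp
    also have "\<dots> \<le> \<bar>\<tau>\<bar> * C" by (intro mult_left_mono) (auto simp: C_def)
    also have "\<dots> < e * C" using \<tau>(2) C by simp
    also have "\<dots> \<le> norm (q j v)" using C by (simp add: e_def min_def field_simps)
    finally show False by simp
  qed
qed

text \<open>Differentiability tested on pairs of points near \<open>x\<close>, not only against
  \<open>x\<close> itself. This controls the secants of \<open>Y\<close>, which is what makes a
  coordinate projection injective on \<open>Y\<close> near a point.\<close>

definition strict_derivative :: "('a::real_normed_vector \<Rightarrow> 'b::real_normed_vector) \<Rightarrow> 'a \<Rightarrow> ('a \<Rightarrow> 'b) \<Rightarrow> bool" where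
  "strict_derivative f x B \<longleftrightarrow> linear B \<and>
     (\<forall>\<eta>>0. \<exists>\<delta>>0. \<forall>y\<in>ball x \<delta>. \<forall>z\<in>ball x \<delta>. norm (f y - f z - B (y - z)) \<le> \<eta> * norm (y - z))"

text \<open>Degrees 0 and 1 account for \<open>q 1 (y - z)\<close>. The Lipschitz bounds of the
  higher degrees sum to at most \<open>2 * M * (K * \<rho>)\<close> times the distance, a factor
  that is small with \<open>\<rho>\<close>.\<close>

lemma real_analytic_on_strict_derivative:
  assumes "real_analytic_on f U" "x \<in> U"
  obtains B where "strict_derivative f x B"
proof -
  obtain r q M K where r: "r > 0" and hs: "homogeneous_series q M K"
    and sums: "\<And>w. norm w < r \<Longrightarrow> (\<lambda>j. q j w) sums f (x + w)"
    using real_analytic_on_expansion[OF assms] by metis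
  note h = homogeneous_seriesD[OF hs]
  have "\<exists>\<delta>>0. \<forall>y\<in>ball x \<delta>. \<forall>z\<in>ball x \<delta>. norm (f y - f z - q 1 (y - z)) \<le> \<eta> * norm (y - z)"
    if \<eta>: "\<eta> > 0" for \<eta>
  proof -
    define \<rho> where "\<rho> = min r (min (1 / (2 * K)) (\<eta> / (2 * M * K)))"
    have \<rho>: "\<rho> > 0" "\<rho> \<le> r" using r h(1,2) \<eta> by (auto simp: \<rho>_def)
    have "\<rho> \<le> 1 / (2 * K)" "\<rho> \<le> \<eta> / (2 * M * K)" by (auto simp: \<rho>_def)
    then have \<rho>': "K * \<rho> \<le> 1 / 2" "2 * M * (K * \<rho>) \<le> \<eta>"
      using h(1,2) by (auto simp: field_simps)
    have "norm (f y - f z - q 1 (y - z)) \<le> \<eta> * norm (y - z)"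
      if "y \<in> ball x \<rho>" "z \<in> ball x \<rho>" for y z
    proof -
      define w w' where "w = y - x" and "w' = z - x"
      have w: "norm w < \<rho>" "norm w' < \<rho>" "y = x + w" "z = x + w'"
        using that by (auto simp: w_def w'_def dist_norm norm_minus_commute)
      define \<kappa> where "\<kappa> = K * \<rho>"
      have \<kappa>: "0 \<le> \<kappa>" "\<kappa> \<le> 1 / 2" using h(2) \<rho> \<rho>' by (auto simp: \<kappa>_def)
      have "(\<lambda>j. q j w - q j w') sums (f y - f z)"
        unfolding w(3,4) using w \<rho> by (intro sums_diff sums) auto
      then have "(\<lambda>j. q (j + 2) w - q (j + 2) w') sums (f y - f z - (\<Sum>j<2. q j w - q j w'))"
        by (rule sums_split_initial_segment)
      moreover have "(\<Sum>j<2. q j w - q j w') = q 1 (y - z)"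
        using homogeneous_series_0[OF hs, of w] homogeneous_series_0[OF hs, of w'] linear_diff[OF h(3), of w w']
        by (simp add: w lessThan_Suc numeral_2_eq_2)
      ultimately have tail: "(\<lambda>j. q (j + 2) w - q (j + 2) w') sums (f y - f z - q 1 (y - z))" by simp
      have geo: "(\<lambda>j. M * \<kappa> * norm (w - w') * \<kappa> ^ j) sums (M * \<kappa> * norm (w - w') * (1 / (1 - \<kappa>)))"
        using \<kappa> by (intro sums_mult geometric_sums) simp
      have "norm (f y - f z - q 1 (y - z)) \<le> M * \<kappa> * norm (w - w') * (1 / (1 - \<kappa>))"
        using norm_suminf_le[of "\<lambda>j. q (j + 2) w - q (j + 2) w'" "\<lambda>j. M * \<kappa> * norm (w - w') * \<kappa> ^ j"]
          h(6)[of w \<rho> w' "Suc _"] w sums_unique[OF tail] sums_unique[OF geo] sums_summable[OF geo]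
        by (simp add: \<kappa>_def mult_ac)
      also have "\<dots> \<le> M * \<kappa> * norm (w - w') * 2"
        using \<kappa> h(1) by (intro mult_left_mono) (auto simp: field_simps)
      also have "\<dots> = 2 * M * (K * \<rho>) * norm (y - z)" by (simp add: \<kappa>_def w mult_ac)
      also have "\<dots> \<le> \<eta> * norm (y - z)" using \<rho>' by (intro mult_right_mono) auto
      finally show ?thesis .
    qed
    then show ?thesis using \<rho> by blast
  qed
  then show thesis using that[of "q 1"] h(3) by (simp add: strict_derivative_def)
qed

lemma strict_derivative_has_derivative:
  fixes f :: "'a::euclidean_space \<Rightarrow> 'b::euclidean_space"
  assumes "strict_derivative f x B"
  shows "(f has_derivative B) (at x)"
  unfolding has_derivative_at_alt
proof (intro conjI allI impI)
  show "bounded_linear B" using assms by (simp add: strict_derivative_def linear_conv_bounded_linear)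
  fix e :: real assume "e > 0"
  then obtain \<delta> where "\<delta> > 0" "\<forall>y\<in>ball x \<delta>. \<forall>z\<in>ball x \<delta>. norm (f y - f z - B (y - z)) \<le> e * norm (y - z)"
    using assms unfolding strict_derivative_def by blast
  then show "\<exists>d>0. \<forall>y. norm (y - x) < d \<longrightarrow> norm (f y - f x - B (y - x)) \<le> e * norm (y - x)"
    by (intro exI[of _ \<delta>]) (auto simp: dist_norm norm_minus_commute)
qed

text \<open>The set of times on a chord where the function vanishes locally is both open and closed.\<close>

lemma real_analytic_on_convex_identity:
  assumes an: "real_analytic_on \<psi> V" and D: "convex D" "D \<subseteq> V" and z: "z \<in> D"
    and \<delta>: "\<delta> > 0" "\<And>u. u \<in> ball z \<delta> \<inter> D \<Longrightarrow> a \<bullet> \<psi> u = c" and w: "w \<in> D"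
  shows "a \<bullet> \<psi> w = c"
proof -
  define v where "v = w - z"
  define k where "k s = a \<bullet> \<psi> (z + s *\<^sub>R v)" for s
  have inD: "z + s *\<^sub>R v \<in> D" if "s \<in> {0..1}" for s
    using convexD_alt[OF D(1) z w, of s] that by (simp add: v_def algebra_simps)
  define S where "S = {s\<in>{0..1}. \<exists>e>0. \<forall>t\<in>{0..1}. \<bar>t - s\<bar> < e \<longrightarrow> k t = c}"
  have "0 \<in> S"
  proof -
    have "k t = c" if "t \<in> {0..1}" "\<bar>t\<bar> < \<delta> / (norm v + 1)" for t
    proof -
      have "\<bar>t\<bar> * norm v \<le> \<bar>t\<bar> * (norm v + 1)" by (intro mult_left_mono) auto
      also have "\<dots> < \<delta>" using that(2) by (simp add: pos_less_divide_eq add_nonneg_pos)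
      finally show ?thesis unfolding k_def using that(1) by (intro \<delta>(2)) (auto simp: dist_norm inD)
    qed
    moreover have "\<delta> / (norm v + 1) > 0" using \<delta>(1) by (simp add: add_nonneg_pos)
    ultimately show ?thesis unfolding S_def by auto
  qed
  have op: "openin (top_of_set {0..1}) S"
    unfolding openin_euclidean_subtopology_iff
  proof (intro conjI ballI)
    show "S \<subseteq> {0..1}" by (auto simp: S_def)
    fix s assume "s \<in> S"
    then obtain e where e: "e > 0" "\<forall>t\<in>{0..1}. \<bar>t - s\<bar> < e \<longrightarrow> k t = c" by (auto simp: S_def)
    have "s' \<in> S" if "s' \<in> {0..1}" "dist s' s < e / 2" for s'
    proof -
      have "k t = c" if "t \<in> {0..1}" "\<bar>t - s'\<bar> < e / 2" for t
      proof -
        have "\<bar>t - s\<bar> < e" using that(2) \<open>dist s' s < e / 2\<close> unfolding dist_real_def by arith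
        then show ?thesis using e that by blast
      qed
      then show ?thesis using that(1) e(1) unfolding S_def by (intro CollectI conjI exI[of _ "e / 2"]) auto
    qed
    then show "\<exists>e>0. \<forall>s'\<in>{0..1}. dist s' s < e \<longrightarrow> s' \<in> S"
      using e(1) by (intro exI[of _ "e / 2"]) auto
  qed
  have cl: "closedin (top_of_set {0..1}) S"
    unfolding closedin_limpt
  proof (intro conjI allI impI)
    show "S \<subseteq> {0..1}" by (auto simp: S_def)
    fix s assume s: "s islimpt S \<and> s \<in> {0..1}"
    \<comment> \<open>Expansion at the limit time \<open>s\<close>: times in \<open>S\<close>
      accumulating at \<open>s\<close> are zeros of \<open>k - c\<close>, so every homogeneous part
      vanishes along \<open>v\<close> and \<open>k = c\<close> holds on an interval around
      \<open>s\<close>.\<close>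
    obtain r q0 M0 K0 where r: "r > 0" and hs0: "homogeneous_series q0 M0 K0"
      and sums0: "\<And>w. norm w < r \<Longrightarrow> (\<lambda>j. q0 j w) sums \<psi> (z + s *\<^sub>R v + w)"
      using real_analytic_on_expansion[OF an] inD[of s] s D(2) by (metis subsetD)
    define q where "q j w = a \<bullet> q0 j w - (if j = 0 then c else 0)" for j w
    have hs: "homogeneous_series q (norm a * M0 + \<bar>c\<bar> + M0) K0"
      unfolding q_def using homogeneous_series_inner[OF hs0] .
    define e0 where "e0 = r / (norm v + 1)"
    have e0: "e0 > 0" using r by (simp add: e0_def add_nonneg_pos)
    have small: "norm (\<tau> *\<^sub>R v) < r" if "\<bar>\<tau>\<bar> < e0" for \<tau>
    proof -
      have "\<bar>\<tau>\<bar> * norm v \<le> \<bar>\<tau>\<bar> * (norm v + 1)" by (intro mult_left_mono) auto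
      also have "\<dots> < r" using that by (simp add: e0_def pos_less_divide_eq add_nonneg_pos)
      finally show ?thesis by simp
    qed
    have sums: "(\<lambda>j. q j (\<tau> *\<^sub>R v)) sums (k (s + \<tau>) - c)" if "\<bar>\<tau>\<bar> < e0" for \<tau>
    proof -
      have "(\<lambda>j. a \<bullet> q0 j (\<tau> *\<^sub>R v)) sums k (s + \<tau>)"
        unfolding k_def using sums0[OF small[OF that]]
        by (intro bounded_linear.sums[OF bounded_linear_inner_right]) (simp add: scaleR_add_left add.assoc)
      then show ?thesis unfolding q_def by (intro sums_diff sums_If_finite_set'[of "\<lambda>_. 0" _ "{0::nat}", simplified])
          (auto intro: sums_single)
    qed
    have "q j v = 0" for j
    proof (rule homogeneous_series_vanish_ray[OF hs])
      fix e :: real assume "e > 0"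
      then obtain t where t: "t \<in> S" "t \<noteq> s" "\<bar>t - s\<bar> < min e e0"
        using s e0 unfolding islimpt_approachable dist_real_def by (metis min_less_iff_conj)
      then have "k t = c" by (force simp: S_def)
      then have "(\<lambda>j. q j ((t - s) *\<^sub>R v)) sums 0" using sums[of "t - s"] t by simp
      then show "\<exists>\<tau>. \<tau> \<noteq> 0 \<and> \<bar>\<tau>\<bar> < e \<and> (\<lambda>j. q j (\<tau> *\<^sub>R v)) sums 0"
        using t by (intro exI[of _ "t - s"]) auto
    qed
    then have "k (s + \<tau>) = c" if "\<bar>\<tau>\<bar> < e0" for \<tau>
      using sums[OF that] homogeneous_seriesD(4)[OF hs, of _ \<tau> v] by (auto simp: sums_0 dest: sums_unique2[OF sums_zero])
    from this[of "_ - s"] show "s \<in> S" using s e0 unfolding S_def by auto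
  qed
  have "S = {} \<or> S = {0..1}"
    using connected_clopen[of "{0..1::real}"] op cl by auto
  then have "1 \<in> S" using \<open>0 \<in> S\<close> by auto
  then have "k 1 = c" by (force simp: S_def)
  then show ?thesis by (simp add: k_def v_def)
qed

section \<open>Nested rational lines\<close>

definition rational_vec :: "real ^ 'n::finite \<Rightarrow> bool" where
  "rational_vec x \<longleftrightarrow> (\<forall>i. x $ i \<in> \<rat>)"

definition coord_space :: "'n set \<Rightarrow> (real ^ 'n::finite) set" where
  "coord_space I = {x. \<forall>i. i \<notin> I \<longrightarrow> x $ i = 0}"

text \<open>The tolerance is a separate argument because it is used with \<open>f t\<close>, with
  \<open>f t / 2\<close> and with the Dirichlet rate.\<close>

definition approx_at :: "real \<Rightarrow> real \<Rightarrow> real ^ 'n::finite \<Rightarrow> bool" where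
  "approx_at b t y \<longleftrightarrow> (\<exists>(q::int) (p :: int ^ 'n). q \<noteq> 0 \<and> real_of_int \<bar>q\<bar> \<le> t \<and>
      infnorm (real_of_int q *\<^sub>R y - (\<chi> i. real_of_int (p $ i))) \<le> b)"

lemma subspace_coord_space: "subspace (coord_space I)"
  by (auto simp: coord_space_def subspace_def)

lemma UA_iff_approx_at: "x \<in> UA f \<longleftrightarrow> (\<forall>\<^sub>F t in at_top. approx_at (f t) t x)"
  by (simp add: UA_def approx_at_def)

lemma approx_at_mono: "approx_at b t y \<Longrightarrow> b \<le> b' \<Longrightarrow> approx_at b' t y"
  unfolding approx_at_def by (meson order_trans)

section \<open>Simultaneous approximation over a rational line\<close>

lemma infnorm_cart_le:
  fixes x :: "real ^ 'n::finite"
  assumes "\<And>i. \<bar>x $ i\<bar> \<le> b"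
  shows "infnorm x \<le> b"
  unfolding infnorm_Max using assms
  by (subst Max_le_iff) (auto simp: Basis_vec_def inner_axis)

lemma common_denominator:
  assumes "finite S" "S \<subseteq> \<rat>"
  shows "\<exists>N::int. N > 0 \<and> (\<forall>r\<in>S. of_int N * (r::real) \<in> \<int>)"
  using assms
proof (induction S rule: finite_induct)
  case empty
  show ?case by (intro exI[of _ 1]) auto
next
  case (insert r S)
  then obtain N :: int where N: "N > 0" "\<forall>r\<in>S. of_int N * r \<in> \<int>" by auto
  obtain a b :: int where ab: "b > 0" "r = of_int a / of_int b"
    using insert.prems by (auto elim: Rats_cases')
  have "of_int (N * b) * r' \<in> \<int>" if "r' \<in> S" for r'
  proof -
    have "of_int (N * b) * r' = of_int b * (of_int N * r')" by simp
    also have "\<dots> \<in> \<int>" using N(2) that by (blast intro: Ints_mult Ints_of_int)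
    finally show ?thesis .
  qed
  moreover have "of_int (N * b) * r \<in> \<int>" using ab by auto
  ultimately show ?case using N(1) ab(1) by (intro exI[of _ "N * b"]) auto
qed

text \<open>Besides the coordinates outside \<open>I\<close>, the only free parameter of the affine subspace is the
  position \<open>\<sigma>\<close> on the rational line.\<close>

lemma Dirichlet_over_rational_line:
  fixes x v :: "real ^ 'n::finite" and I :: "'n set"
  assumes "rational_vec x" "rational_vec v" and m: "m = Suc (card (- I))"
  shows "\<exists>C>0. \<exists>T>0. \<forall>\<sigma> y t. t \<ge> T \<longrightarrow> (\<forall>i\<in>I. y $ i = x $ i + \<sigma> * v $ i) \<longrightarrow>
           approx_at (C * t powr - (1 / real m)) t y"
proof -
  have "\<exists>N::int. N > 0 \<and> (\<forall>r\<in>range (vec_nth x) \<union> range (vec_nth v). of_int N * r \<in> \<int>)"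
    using assms(1,2) by (intro common_denominator) (auto simp: rational_vec_def)
  then obtain N :: int where N: "N > 0" "\<And>i. of_int N * x $ i \<in> \<int>" "\<And>i. of_int N * v $ i \<in> \<int>"
    by auto
  have "\<exists>a. \<forall>i. of_int N * x $ i = of_int (a i)" "\<exists>b. \<forall>i. of_int N * v $ i = of_int (b i)"
    using N(2,3) unfolding Ints_def by (intro choice; auto)+
  then obtain a b where ab: "\<And>i. of_int N * x $ i = of_int (a i)" "\<And>i. of_int N * v $ i = of_int (b i)"
    by metis
  obtain h where h: "bij_betw h {0..<card (- I)} (- I)"
    using ex_bij_betw_nat_finite[of "- I"] by auto
  \<comment> \<open>Rounding errors are multiplied by \<open>b i\<close> for coordinates in
    \<open>I\<close> and by \<open>N\<close> for the others; \<open>K\<close> bounds both.\<close>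
  define K where "K = of_int N + (\<Sum>i\<in>UNIV. real_of_int \<bar>b i\<bar>)"
  have K: "K > 0" "K \<ge> of_int N" "K \<ge> \<bar>real_of_int (b i)\<bar>" for i
    using N(1) member_le_sum[of i UNIV "\<lambda>i. real_of_int \<bar>b i\<bar>"]
    by (auto simp: K_def sum_nonneg add_pos_nonneg)
  \<comment> \<open>The 2 pays for rounding \<open>s\<close> down to the integer \<open>M\<close>,
    the power of \<open>N\<close> for using the denominator \<open>N * q\<close> in place of
    \<open>q\<close>.\<close>
  define C where "C = 2 * K * of_int N powr (1 / real m)"
  have C: "C > 0" using K N by (simp add: C_def)
  have "approx_at (C * t powr - (1 / real m)) t y"
    if t: "t \<ge> of_int N" and y: "\<forall>i\<in>I. y $ i = x $ i + \<sigma> * v $ i" for \<sigma> y t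
  proof -
    \<comment> \<open>Chosen so that \<open>M ^ m\<close> is at most \<open>t / N\<close>, whence
      \<open>N * q\<close> is at most \<open>t\<close>.\<close>
    define s where "s = (t / of_int N) powr (1 / real m)"
    have s: "s \<ge> 1" unfolding s_def using t N by (intro ge_one_powr_ge_zero) auto
    define M where "M = nat \<lfloor>s\<rfloor>"
    have "\<lfloor>s\<rfloor> \<ge> 1" using s by simp
    then have fl: "real_of_int \<lfloor>s\<rfloor> \<ge> 1" by (metis of_int_1_le_iff)
    have "real M = real_of_int \<lfloor>s\<rfloor>" using s by (simp add: M_def)
    then have M: "M > 0" "real M \<le> s" "real M \<ge> s / 2"
      using fl by (simp, linarith+)
    \<comment> \<open>The \<open>m\<close> numbers to approximate: the free coordinates, numbered by
      \<open>h\<close>, and the line parameter as the last entry.\<close>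
    define \<theta> where "\<theta> k = (if k < card (- I) then y $ h k else \<sigma>)" for k
    obtain q p where qp: "0 < q" "q \<le> int (M ^ m)"
      "\<And>i. i < m \<Longrightarrow> \<bar>of_int q * \<theta> i - of_int (p i)\<bar> < 1 / M"
      using Dirichlet_approx_simult[OF M(1), where n = m and \<theta> = \<theta>] by metis
    \<comment> \<open>For \<open>i\<close> in \<open>I\<close> one has
      \<open>N * q * y $ i = q * a i + (q * \<sigma>) * b i\<close>, and only
      \<open>q * \<sigma>\<close> has to be rounded.\<close>
    define P where "P = (\<chi> i. if i \<in> I then q * a i + p (card (- I)) * b i
        else N * p (the_inv_into {0..<card (- I)} h i))"
    have "real M ^ m \<le> s ^ m" using M by (intro power_mono) auto
    also have "s ^ m = t / of_int N"
    proof -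
      have "real m \<noteq> 0" "t / of_int N > 0" using m t N by auto
      moreover have "s ^ m = s powr real m" using s by (simp add: powr_realpow)
      ultimately show ?thesis using t N by (simp add: s_def powr_powr)
    qed
    finally have "real_of_int (N * q) \<le> t"
    proof -
      assume *: "real M ^ m \<le> t / of_int N"
      have "real_of_int q \<le> real M ^ m" using qp(2) by (metis of_int_le_iff of_int_of_nat_eq of_nat_power)
      then have "real_of_int q \<le> t / of_int N" using * by linarith
      then show ?thesis using N by (simp add: field_simps)
    qed
    moreover have "\<bar>(real_of_int (N * q) *\<^sub>R y - (\<chi> i. real_of_int (P $ i))) $ i\<bar> \<le> K * (1 / M)" for i
    proof (cases "i \<in> I")
      case True
      have "real_of_int (N * q) * y $ i = q * (of_int N * x $ i) + (q * \<sigma>) * (of_int N * v $ i)"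
        using y True by (simp add: algebra_simps)
      also have "\<dots> = q * a i + q * \<sigma> * b i" by (simp only: ab of_int_mult)
      finally have "real_of_int (N * q) * y $ i - real_of_int (P $ i) = (q * \<theta> (card (- I)) - p (card (- I))) * b i"
        using True by (simp add: P_def \<theta>_def algebra_simps)
      also have "\<bar>\<dots>\<bar> \<le> (1 / M) * K"
        unfolding abs_mult using qp(3)[of "card (- I)"] m K(3)[of i] by (intro mult_mono) auto
      finally show ?thesis by simp
    next
      case False
      define k where "k = the_inv_into {0..<card (- I)} h i"
      have k: "k < card (- I)" "h k = i"
        using False h the_inv_into_into[of h "{0..<card (- I)}" i "{0..<card (- I)}"]
          f_the_inv_into_f_bij_betw[OF h, of i]
        by (auto simp: k_def bij_betw_def)
      have "real_of_int (N * q) * y $ i - real_of_int (P $ i) = (q * \<theta> k - p k) * N"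
        using False k by (simp add: P_def k_def[symmetric] \<theta>_def algebra_simps)
      also have "\<bar>\<dots>\<bar> \<le> (1 / M) * K"
        unfolding abs_mult using qp(3)[of k] k m N(1) K(2) by (intro mult_mono) auto
      finally show ?thesis by simp
    qed
    then have "infnorm (real_of_int (N * q) *\<^sub>R y - (\<chi> i. real_of_int (P $ i))) \<le> K * (1 / M)"
      by (rule infnorm_cart_le)
    moreover have "K * (1 / M) \<le> C * t powr - (1 / real m)"
    proof -
      have "K * (1 / M) \<le> K * (2 / s)"
        using M s K(1) by (intro mult_left_mono) (auto simp: field_simps)
      also have "\<dots> = C * t powr - (1 / real m)"
        using t N by (simp add: s_def C_def powr_divide powr_minus_divide)
      finally show ?thesis .
    qed
    ultimately show ?thesis
      unfolding approx_at_def using qp(1) N(1)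
      by (intro exI[of _ "N * q"] exI[of _ P]) (auto simp: abs_mult)
  qed
  then show ?thesis using C N(1) by (intro exI[of _ C] conjI exI[of _ "real_of_int N"]) auto
qed

text \<open>What matters is the order of the quantifiers: \<open>T\<close> depends on the line, but
  not on \<open>\<sigma>\<close> or on the coordinates outside \<open>I\<close>. The factor 1/2 is
  slack for moving the point later.\<close>

lemma eventually_approx_over_rational_line:
  fixes x v :: "real ^ 'n::finite" and I :: "'n set"
  assumes "rational_vec x" "rational_vec v"
    and lim: "filterlim (\<lambda>t. t powr (1 / real (Suc (card (- I)))) * f t) at_top at_top"
  shows "\<exists>T>0. \<forall>\<sigma> y t. t \<ge> T \<longrightarrow> (\<forall>i\<in>I. y $ i = x $ i + \<sigma> * v $ i) \<longrightarrow> approx_at (f t / 2) t y"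
proof -
  define m where "m = Suc (card (- I))"
  obtain C T where C: "C > 0" "T > 0" "\<And>\<sigma> y t. t \<ge> T \<Longrightarrow> (\<forall>i\<in>I. y $ i = x $ i + \<sigma> * v $ i) \<Longrightarrow>
           approx_at (C * t powr - (1 / real m)) t y"
    using Dirichlet_over_rational_line[OF assms(1,2) m_def] by metis
  obtain T' where T': "\<And>t. t \<ge> T' \<Longrightarrow> 2 * C \<le> t powr (1 / real m) * f t"
    using lim unfolding m_def[symmetric] filterlim_at_top eventually_at_top_linorder by blast
  have "approx_at (f t / 2) t y"
    if "t \<ge> max T T'" "\<forall>i\<in>I. y $ i = x $ i + \<sigma> * v $ i" for t y \<sigma>
  proof (rule approx_at_mono)
    show "approx_at (C * t powr - (1 / real m)) t y" using that by (intro C(3)) auto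
    have "t > 0" using that C(2) by auto
    then show "C * t powr - (1 / real m) \<le> f t / 2"
      using T'[of t] that by (simp add: powr_minus_divide field_simps)
  qed
  then show ?thesis using C(2) by (intro exI[of _ "max T T'"]) auto
qed

text \<open>The old \<open>q\<close> and \<open>p\<close> still work. Since the modulus of
  \<open>q\<close> is at most \<open>T'\<close>, the displacement adds at most
  \<open>f T' / 2\<close>, and \<open>f T' \<le> f t\<close> on the range by monotonicity.\<close>

lemma approx_at_nearby:
  fixes y :: "real ^ 'n::finite"
  assumes "0 < T" "\<And>t. t \<ge> T \<Longrightarrow> approx_at (f t / 2) t y"
    and "\<And>t. t > 0 \<Longrightarrow> f t > 0" "antimono_on {0<..} f" "T \<le> T'"
  shows "\<exists>\<eta>>0. \<forall>y'. norm (y' - y) < \<eta> \<longrightarrow> (\<forall>t\<in>{T..T'}. approx_at (f t) t y')"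
proof (intro exI[of _ "f T' / (2 * T')"] conjI allI impI ballI)
  show "f T' / (2 * T') > 0" using assms(1,5) assms(3)[of T'] by (auto intro!: divide_pos_pos)
  fix y' :: "real ^ 'n" and t assume y': "norm (y' - y) < f T' / (2 * T')" and t: "t \<in> {T..T'}"
  obtain q p where qp: "q \<noteq> 0" "real_of_int \<bar>q\<bar> \<le> t"
      "infnorm (real_of_int q *\<^sub>R y - (\<chi> i. real_of_int (p $ i))) \<le> f t / 2"
    using assms(2)[of t] t unfolding approx_at_def by auto
  have "real_of_int q *\<^sub>R y' - (\<chi> i. real_of_int (p $ i))
      = (real_of_int q *\<^sub>R y - (\<chi> i. real_of_int (p $ i))) + real_of_int q *\<^sub>R (y' - y)"
    by (simp add: scaleR_diff_right)
  then have "infnorm (real_of_int q *\<^sub>R y' - (\<chi> i. real_of_int (p $ i)))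
      \<le> infnorm (real_of_int q *\<^sub>R y - (\<chi> i. real_of_int (p $ i))) + \<bar>real_of_int q\<bar> * infnorm (y' - y)"
    using infnorm_triangle infnorm_mul by metis
  also have "\<dots> \<le> f t / 2 + T' * (f T' / (2 * T'))"
    using qp t y' infnorm_le_norm[of "y' - y"] assms(1)
    by (intro add_mono mult_mono) (auto simp: infnorm_pos_le)
  also have "\<dots> \<le> f t / 2 + f t / 2"
    using assms(1,4,5) t monotone_onD[OF assms(4), of t T'] by auto
  finally show "approx_at (f t) t y'" unfolding approx_at_def using qp by auto
qed

section \<open>The nested construction in a coordinate plane\<close>

lemma rational_approx_coord_space:
  assumes "u \<in> coord_space I" "\<epsilon> > 0"
  obtains r where "rational_vec r" "r \<in> coord_space I" "norm (r - u) < \<epsilon>"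
proof -
  define e where "e = \<epsilon> / (2 * CARD('a))"
  have e: "e > 0" using assms(2) by (simp add: e_def)
  have "\<exists>r\<in>\<rat>. \<bar>r - u $ i\<bar> < e" for i
    using rational_approximation[OF e, of "u $ i"] by metis
  then obtain \<rho> where \<rho>: "\<And>i. \<rho> i \<in> \<rat>" "\<And>i. \<bar>\<rho> i - u $ i\<bar> < e" by metis
  define r where "r = (\<chi> i. if i \<in> I then \<rho> i else 0)"
  have "norm (r - u) \<le> (\<Sum>i\<in>(UNIV::'a set). \<bar>(r - u) $ i\<bar>)" by (rule norm_le_l1_cart)
  also have "\<dots> \<le> (\<Sum>i\<in>(UNIV::'a set). e)"
    using assms(1) \<rho>(2) e by (intro sum_mono) (auto simp: r_def coord_space_def less_imp_le)
  also have "\<dots> < \<epsilon>" using assms(2) by (simp add: e_def)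
  finally show thesis using \<rho>(1) by (intro that[of r]) (auto simp: r_def rational_vec_def coord_space_def)
qed

text \<open>A state is a rational centre, a radius and a time from which on the point over the
  centre is approximated with tolerance \<open>f t / 2\<close>. Step \<open>n\<close> shrinks the
  ball so that all points over it avoid \<open>C n\<close> and are approximated with tolerance
  \<open>f t\<close> in the window between the old and the new time. A point common to all balls
  inherits every window and avoids every \<open>C n\<close>.\<close>

lemma nested_rational_lines:
  fixes g :: "real ^ 'n::finite \<Rightarrow> real ^ 'n" and C :: "nat \<Rightarrow> (real ^ 'n) set" and I :: "'n set"
  defines "E \<equiv> coord_space I"
  assumes op: "openin (top_of_set E) \<Omega>" and ne: "\<Omega> \<noteq> {}" and cont: "continuous_on \<Omega> g"
    and sect: "\<And>u i. u \<in> \<Omega> \<Longrightarrow> i \<in> I \<Longrightarrow> g u $ i = u $ i"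
    and clos: "\<And>l. closedin (top_of_set \<Omega>) {u \<in> \<Omega>. g u \<in> C l}"
    and esc: "\<And>l x. x \<in> \<Omega> \<Longrightarrow> rational_vec x \<Longrightarrow> \<exists>v\<in>E. rational_vec v \<and>
        (\<exists>\<epsilon>>0. \<forall>s. 0 < s \<and> s < \<epsilon> \<and> x + s *\<^sub>R v \<in> \<Omega> \<longrightarrow> g (x + s *\<^sub>R v) \<notin> C l)"
    and fpos: "\<And>t. t > 0 \<Longrightarrow> f t > 0" and anti: "antimono_on {0<..} f"
    and lim: "filterlim (\<lambda>t. t powr (1 / real (Suc (card (- I)))) * f t) at_top at_top"
  shows "\<exists>u\<in>\<Omega>. g u \<in> UA f \<and> (\<forall>l. g u \<notin> C l)"
proof -
  have subE: "subspace E" by (simp add: E_def subspace_coord_space)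
  have \<Omega>E: "\<Omega> \<subseteq> E" using op by (rule openin_imp_subset)
  have nbhd: "\<exists>\<delta>>0. E \<inter> cball x \<delta> \<subseteq> S" if "openin (top_of_set E) S" "x \<in> S" for S x
    using that openin_contains_cball[of E S] by (metis Int_commute)
  define st where "st = (\<lambda>(x, \<delta>, T). rational_vec x \<and> x \<in> E \<and> \<delta> > 0 \<and> T > 0 \<and> E \<inter> cball x \<delta> \<subseteq> \<Omega> \<and>
      (\<forall>t\<ge>T. approx_at (f t / 2) t (g x)))"
  \<comment> \<open>The gain of at least 1 in time makes the windows cover everything after the
    first time.\<close>
  define step where "step = (\<lambda>n (x, \<delta>, T) (x', \<delta>', T'). E \<inter> cball x' \<delta>' \<subseteq> E \<inter> cball x \<delta> \<and> T' \<ge> T + 1 \<and>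
      (\<forall>u\<in>E \<inter> cball x' \<delta>'. g u \<notin> C n \<and> (\<forall>t\<in>{T..T'}. approx_at (f t) t (g u))))"
  have ex0: "\<exists>s. st s"
  proof -
    obtain u where u: "u \<in> \<Omega>" using ne by auto
    obtain e where e: "e > 0" "E \<inter> cball u e \<subseteq> \<Omega>" using nbhd[OF op u] by auto
    obtain x where x: "rational_vec x" "x \<in> E" "norm (x - u) < e"
      using rational_approx_coord_space[of u I e] u \<Omega>E e(1) unfolding E_def by blast
    have x\<Omega>: "x \<in> \<Omega>" using x e by (auto simp: dist_norm norm_minus_commute)
    obtain \<delta> where \<delta>: "\<delta> > 0" "E \<inter> cball x \<delta> \<subseteq> \<Omega>" using nbhd[OF op x\<Omega>] by auto
    \<comment> \<open>Only the point over \<open>x\<close> itself matters here, so any rational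
      direction serves; \<open>x\<close> is taken, with parameter 0.\<close>
    obtain T where T: "T > 0" "\<And>\<sigma> y t. t \<ge> T \<Longrightarrow> (\<forall>i\<in>I. y $ i = x $ i + \<sigma> * x $ i) \<Longrightarrow> approx_at (f t / 2) t y"
      using eventually_approx_over_rational_line[OF x(1) x(1) lim] by blast
    have "st (x, \<delta>, T)"
      using x \<delta> T(1) T(2)[of _ "g x" 0] sect[OF x\<Omega>] by (auto simp: st_def)
    then show ?thesis ..
  qed
  have exS: "\<exists>s'. st s' \<and> step n s s'" if "st s" for s n
  proof -
    obtain x \<delta> T where s: "s = (x, \<delta>, T)" by (cases s) auto
    have x: "rational_vec x" "x \<in> E" "\<delta> > 0" "T > 0" "E \<inter> cball x \<delta> \<subseteq> \<Omega>"
      "\<And>t. t \<ge> T \<Longrightarrow> approx_at (f t / 2) t (g x)"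
      using that by (auto simp: s st_def)
    have x\<Omega>: "x \<in> \<Omega>" using x by auto
    obtain v \<epsilon> where v: "v \<in> E" "rational_vec v" "\<epsilon> > 0"
      "\<And>s. 0 < s \<Longrightarrow> s < \<epsilon> \<Longrightarrow> x + s *\<^sub>R v \<in> \<Omega> \<Longrightarrow> g (x + s *\<^sub>R v) \<notin> C n"
      using esc[OF x\<Omega> x(1), of n] by blast
    obtain T1 where T1: "T1 > 0"
      "\<And>\<sigma> y t. t \<ge> T1 \<Longrightarrow> (\<forall>i\<in>I. y $ i = x $ i + \<sigma> * v $ i) \<Longrightarrow> approx_at (f t / 2) t y"
      using eventually_approx_over_rational_line[OF x(1) v(2) lim] by blast
    \<comment> \<open>\<open>T1\<close> depends only on the line, so \<open>T'\<close> is known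
      before the step length \<open>\<sigma>\<close> is chosen; \<open>\<sigma>\<close> can then be
      made small enough for the whole window up to \<open>T'\<close>.\<close>
    define T' where "T' = max T1 (T + 1)"
    obtain \<eta> where \<eta>: "\<eta> > 0" "\<And>y' t. norm (y' - g x) < \<eta> \<Longrightarrow> t \<in> {T..T'} \<Longrightarrow> approx_at (f t) t y'"
    proof -
      have "T \<le> T'" by (simp add: T'_def)
      from approx_at_nearby[OF x(4,6) fpos anti this] show thesis using that by blast
    qed
    obtain \<delta>1 where \<delta>1: "\<delta>1 > 0" "\<And>u. u \<in> \<Omega> \<Longrightarrow> dist u x < \<delta>1 \<Longrightarrow> dist (g u) (g x) < \<eta>"
      using cont x\<Omega> \<eta>(1) unfolding continuous_on_iff by metis
    \<comment> \<open>Within distance \<open>\<rho>\<close> of \<open>x\<close> one stays in the old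
      ball and in the region where \<open>g\<close> moves by less than
      \<open>\<eta>\<close>.\<close>
    define \<rho> where "\<rho> = min \<delta> (\<delta>1 / 2)"
    have \<rho>: "\<rho> > 0" "\<rho> \<le> \<delta>" "\<rho> < \<delta>1" using x(3) \<delta>1(1) by (auto simp: \<rho>_def)
    have "min \<epsilon> (\<rho> / (norm v + 1)) > 0" using v(3) \<rho> by (auto intro!: divide_pos_pos add_nonneg_pos)
    then obtain k where k: "inverse (real (Suc k)) < min \<epsilon> (\<rho> / (norm v + 1))"
      using reals_Archimedean by blast
    \<comment> \<open>The reciprocal of a natural number, so that the new centre is rational
      again.\<close>
    define \<sigma> where "\<sigma> = inverse (real (Suc k))"
    have \<sigma>: "\<sigma> > 0" "\<sigma> < \<epsilon>" "\<sigma> \<in> \<rat>" "\<sigma> < \<rho> / (norm v + 1)" using k by (auto simp: \<sigma>_def)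
    define x' where "x' = x + \<sigma> *\<^sub>R v"
    have x'E: "x' \<in> E" unfolding x'_def using subE x(2) v(1) by (simp add: subspace_add subspace_scale)
    have "\<sigma> * norm v \<le> \<sigma> * (norm v + 1)" using \<sigma> by simp
    also have "\<dots> < \<rho>" using \<sigma>(4) by (simp add: pos_less_divide_eq add_nonneg_pos)
    finally have dx: "dist x x' < \<rho>" using \<sigma>(1) by (simp add: x'_def dist_norm)
    then have x'\<Omega>: "x' \<in> \<Omega>" using x'E x(5) \<rho> by auto
    have gx': "g x' \<notin> C n" using v(4)[of \<sigma>] \<sigma> x'\<Omega> by (simp add: x'_def)
    have "openin (top_of_set \<Omega>) (\<Omega> - {u \<in> \<Omega>. g u \<in> C n})"
      using clos[of n] by (metis openin_diff openin_subtopology_self)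
    then have "openin (top_of_set E) (\<Omega> - {u \<in> \<Omega>. g u \<in> C n})"
      using op openin_trans by blast
    then obtain e where e: "e > 0" "E \<inter> cball x' e \<subseteq> \<Omega> - {u \<in> \<Omega>. g u \<in> C n}"
      using nbhd[of _ x'] gx' x'\<Omega> by blast
    define \<delta>' where "\<delta>' = min e (\<rho> - dist x x')"
    have \<delta>': "\<delta>' > 0" "\<delta>' \<le> e" "\<delta>' \<le> \<rho> - dist x x'" using e(1) dx by (auto simp: \<delta>'_def)
    have sub: "cball x' \<delta>' \<subseteq> cball x \<rho>"
    proof
      fix u assume "u \<in> cball x' \<delta>'"
      then show "u \<in> cball x \<rho>" using \<delta>'(3) dist_triangle[of x u x'] by simp
    qed
    have "st (x', \<delta>', T')"
      unfolding st_def prod.case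
    proof (intro conjI allI impI)
      show "rational_vec x'" using x(1) v(2) \<sigma>(3) by (auto simp: x'_def rational_vec_def)
      show "x' \<in> E" "\<delta>' > 0" by fact+
      show "T' > 0" using T1(1) by (simp add: T'_def)
      show "E \<inter> cball x' \<delta>' \<subseteq> \<Omega>" using e(2) \<delta>'(2) by auto
      show "approx_at (f t / 2) t (g x')" if "T' \<le> t" for t
        using that sect[OF x'\<Omega>] by (intro T1(2)[of _ _ \<sigma>]) (auto simp: T'_def x'_def)
    qed
    moreover have "step n s (x', \<delta>', T')"
      unfolding step_def s prod.case
    proof (intro conjI ballI)
      show "E \<inter> cball x' \<delta>' \<subseteq> E \<inter> cball x \<delta>" using sub \<rho> by auto
      show "T + 1 \<le> T'" by (simp add: T'_def)
      fix u assume u: "u \<in> E \<inter> cball x' \<delta>'"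
      then show "g u \<notin> C n" using e(2) \<delta>'(2) by auto
      have "u \<in> \<Omega>" using u e(2) \<delta>'(2) by auto
      moreover have "dist u x < \<delta>1"
      proof -
        have "u \<in> cball x \<rho>" using u sub by blast
        then show ?thesis using \<rho>(3) by (simp add: dist_commute)
      qed
      ultimately show "approx_at (f t) t (g u)" if "t \<in> {T..T'}" for t
        using \<eta>(2)[OF _ that] \<delta>1(2)[of u] by (simp add: dist_norm)
    qed
    ultimately show ?thesis by blast
  qed
  obtain F where F: "\<And>n. st (F n)" "\<And>n. step n (F n) (F (Suc n))"
    using dependent_nat_choice[of "\<lambda>_. st" step] ex0 exS by metis
  define X \<Delta> T where "X n = fst (F n)" and "\<Delta> n = fst (snd (F n))" and "T n = snd (snd (F n))" for n
  have Fn: "F n = (X n, \<Delta> n, T n)" for n by (simp add: X_def \<Delta>_def T_def)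
  define K where "K n = E \<inter> cball (X n) (\<Delta> n)" for n
  have K: "X n \<in> K n" "K n \<subseteq> \<Omega>" "K (Suc n) \<subseteq> K n" "T (Suc n) \<ge> T n + 1"
    "u \<in> K (Suc n) \<Longrightarrow> g u \<notin> C n" "u \<in> K (Suc n) \<Longrightarrow> t \<in> {T n..T (Suc n)} \<Longrightarrow> approx_at (f t) t (g u)" for n u t
    using F(1)[of n] F(2)[of n] by (auto simp: Fn st_def step_def K_def)
  have "\<Inter> (range K) \<noteq> {}"
  proof (rule compact_nest)
    show "compact (K n)" for n
      unfolding K_def by (intro closed_Int_compact closed_subspace subE) auto
    show "K n \<noteq> {}" for n using K(1) by auto
    show "K n \<subseteq> K m" if "m \<le> n" for m n using that K(3) by (rule lift_Suc_antimono_le[rotated])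
  qed
  then obtain u where u: "\<And>n. u \<in> K n" by auto
  have Tn: "T n \<ge> T 0 + real n" for n
  proof (induction n)
    case (Suc n)
    then show ?case using K(4)[of n] by simp
  qed simp
  have "approx_at (f t) t (g u)" if t: "t \<ge> T 0" for t
  proof -
    obtain k where "real k > t - T 0" using reals_Archimedean2 by blast
    then have "T k > t" using Tn[of k] by simp
    then have ex: "\<exists>k. T k > t" ..
    \<comment> \<open>The window containing \<open>t\<close> ends at the first of the times that
      exceeds \<open>t\<close>.\<close>
    define k' where "k' = (LEAST k. T k > t)"
    have k': "T k' > t" unfolding k'_def using ex by (rule LeastI_ex)
    then obtain j where j: "k' = Suc j" using t by (cases k') auto
    have "\<not> T j > t" using not_less_Least[of j "\<lambda>k. T k > t"] j k'_def by auto
    then show ?thesis using K(6)[OF u, of t j] k' j by auto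
  qed
  then have "g u \<in> UA f"
    unfolding UA_iff_approx_at eventually_at_top_linorder by blast
  moreover have "\<forall>l. g u \<notin> C l" using K(5) u by blast
  ultimately show ?thesis using u K(2) by blast
qed

section \<open>Tangent vectors avoiding a forbidden set\<close>

text \<open>The adjacent cone: \<open>y + s *\<^sub>R v\<close> comes within o(s) of
  \<open>Y\<close> for all small \<open>s\<close>, not only along a sequence as in the contingent
  cone. A nearby point of \<open>Y\<close> is later needed at every small \<open>s\<close>.\<close>

definition tangent_at :: "'a::real_normed_vector set \<Rightarrow> 'a \<Rightarrow> 'a \<Rightarrow> bool" where
  "tangent_at Y y v \<longleftrightarrow> (\<forall>\<epsilon>>0. \<exists>\<delta>>0. \<forall>s. 0 < s \<and> s < \<delta> \<longrightarrow> (\<exists>z\<in>Y. norm (z - y - s *\<^sub>R v) \<le> \<epsilon> * s))"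

text \<open>Some tangent vector of \<open>Y\<close> at \<open>y\<close> lies outside the contingent cone of \<open>Y \<inter> C\<close> at \<open>y\<close>.\<close>

definition escapes :: "'a::real_normed_vector set \<Rightarrow> 'a set \<Rightarrow> 'a \<Rightarrow> bool" where
  "escapes Y C y \<longleftrightarrow> (\<exists>v. tangent_at Y y v \<and>
     (\<exists>\<epsilon>>0. \<forall>s. 0 < s \<and> s < \<epsilon> \<longrightarrow> (\<forall>z\<in>Y \<inter> C. norm (z - y - s *\<^sub>R v) \<ge> \<epsilon> * s)))"

text \<open>A slice chart bundled with its derivative at \<open>y\<close> and the inverse of that
  derivative; the image of \<open>L\<close> under \<open>A\<close> is the tangent space of
  \<open>Y\<close> at \<open>y\<close>.\<close>

definition analytic_chart_at where
  "analytic_chart_at d (Y :: (real ^ 'n::finite) set) y U (V :: (real ^ 'n) set) \<phi> \<psi> L B A \<longleftrightarrow>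
     y \<in> U \<and> open U \<and> open V \<and> homeomorphism U V \<phi> \<psi> \<and> real_analytic_on \<psi> V \<and>
     subspace L \<and> dim L = d \<and> (\<forall>z\<in>U. z \<in> Y \<longleftrightarrow> \<phi> z \<in> L) \<and>
     strict_derivative \<phi> y B \<and> linear B \<and> linear A \<and> (\<forall>v. A (B v) = v) \<and> (\<forall>w. B (A w) = w) \<and>
     (\<forall>w\<in>L. tangent_at Y y (A w))"

text \<open>The chain rule for the mutually inverse charts gives \<open>A \<circ> B = id\<close>,
  and equality of dimensions gives the other composition. The tangent vector \<open>A w\<close>
  belongs to the curve \<open>\<psi> (\<phi> y + s *\<^sub>R w)\<close>, which runs in
  \<open>Y\<close> because \<open>L\<close> is a subspace.\<close>

lemma analytic_chart_exists:
  fixes Y :: "(real ^ 'n::finite) set"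
  assumes "analytic_submanifold d Y" "y \<in> Y"
  obtains U V \<phi> \<psi> L B A where "analytic_chart_at d Y y U V \<phi> \<psi> L B A"
proof -
  obtain U \<phi> \<psi> L and V :: "(real ^ 'n) set" where ch: "y \<in> U" "homeomorphism U V \<phi> \<psi>"
      "real_analytic_on \<phi> U" "real_analytic_on \<psi> V"
      "subspace L" "dim L = d" "\<phi> ` (U \<inter> Y) = V \<inter> L"
    using assms(1)[unfolded analytic_submanifold_def, rule_format, OF assms(2)] by (elim exE conjE)
  have op: "open U" "open V" using ch unfolding real_analytic_on_def by auto
  note hm = homeomorphism_apply1[OF ch(2)] homeomorphism_apply2[OF ch(2)]
    homeomorphism_image1[OF ch(2)] homeomorphism_image2[OF ch(2)]
  have Y_iff: "z \<in> Y \<longleftrightarrow> \<phi> z \<in> L" if "z \<in> U" for z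
  proof
    show "\<phi> z \<in> L" if "z \<in> Y" using that \<open>z \<in> U\<close> ch(7) by blast
    assume "\<phi> z \<in> L"
    moreover have "\<phi> z \<in> V" using hm(3) \<open>z \<in> U\<close> by blast
    ultimately have "\<phi> z \<in> \<phi> ` (U \<inter> Y)" unfolding ch(7) by blast
    then obtain z' where z': "\<phi> z = \<phi> z'" "z' \<in> U" "z' \<in> Y" by blast
    have "z = z'" using hm(1)[OF \<open>z \<in> U\<close>] hm(1)[OF z'(2)] unfolding z'(1) by (rule trans[OF sym])
    then show "z \<in> Y" using z'(3) by (rule ssubst)
  qed
  have \<phi>y: "\<phi> y \<in> V" "\<phi> y \<in> L" using ch(1) hm(3) Y_iff assms(2) by blast+
  obtain B where B: "strict_derivative \<phi> y B"
    using real_analytic_on_strict_derivative[OF ch(3,1)] by blast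
  obtain A where A: "strict_derivative \<psi> (\<phi> y) A"
    using real_analytic_on_strict_derivative[OF ch(4) \<phi>y(1)] by blast
  have lin: "linear A" "linear B" using A B by (auto simp: strict_derivative_def)
  note dB = strict_derivative_has_derivative[OF B] and dA = strict_derivative_has_derivative[OF A]
  have "((\<psi> \<circ> \<phi>) has_derivative (A \<circ> B)) (at y)" using dB dA by (rule diff_chain_at)
  then have "((\<lambda>z. z) has_derivative (A \<circ> B)) (at y)"
    by (rule has_derivative_transform_within_open[OF _ op(1) ch(1)]) (simp add: hm(1))
  then have "A \<circ> B = (\<lambda>z. z)" using has_derivative_ident has_derivative_unique by blast
  then have AB: "A \<circ> B = id" by (simp add: id_def)
  then have BA: "B \<circ> A = id" using linear_inverse_left lin by blast
  have AB': "A (B v) = v" and BA': "B (A v) = v" for v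
    using AB BA by (metis comp_apply id_apply)+
  have tan: "tangent_at Y y (A w)" if w: "w \<in> L" for w
    unfolding tangent_at_def
  proof (intro allI impI)
    fix \<epsilon> :: real assume \<epsilon>: "\<epsilon> > 0"
    obtain \<delta>1 where \<delta>1: "\<delta>1 > 0" "\<And>u. norm (u - \<phi> y) < \<delta>1 \<Longrightarrow>
        norm (\<psi> u - \<psi> (\<phi> y) - A (u - \<phi> y)) \<le> \<epsilon> / (norm w + 1) * norm (u - \<phi> y)"
    proof -
      have "\<epsilon> / (norm w + 1) > 0" using \<epsilon> by (simp add: add_nonneg_pos)
      then show thesis using dA that unfolding has_derivative_at_alt by blast
    qed
    obtain \<delta>2 where \<delta>2: "\<delta>2 > 0" "ball (\<phi> y) \<delta>2 \<subseteq> V"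
      using op(2) \<phi>y(1) open_contains_ball by blast
    define \<delta> where "\<delta> = min \<delta>1 \<delta>2 / (norm w + 1)"
    show "\<exists>\<delta>>0. \<forall>s. 0 < s \<and> s < \<delta> \<longrightarrow> (\<exists>z\<in>Y. norm (z - y - s *\<^sub>R A w) \<le> \<epsilon> * s)"
    proof (intro exI[of _ \<delta>] conjI allI impI)
      show "\<delta> > 0" using \<delta>1(1) \<delta>2(1) by (auto simp: \<delta>_def intro!: divide_pos_pos add_nonneg_pos)
      fix s :: real assume s: "0 < s \<and> s < \<delta>"
      define u where "u = \<phi> y + s *\<^sub>R w"
      have "s * norm w \<le> s * (norm w + 1)" using s by simp
      also have "\<dots> < min \<delta>1 \<delta>2" using s by (simp add: \<delta>_def pos_less_divide_eq add_nonneg_pos)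
      finally have u: "norm (u - \<phi> y) < \<delta>1" "u \<in> V" using \<delta>2(2) s by (auto simp: u_def dist_norm)
      have "u \<in> L" unfolding u_def using \<phi>y(2) w ch(5) by (simp add: subspace_add subspace_scale)
      then have "\<psi> u \<in> Y" using Y_iff[of "\<psi> u"] u(2) hm(2,4) by auto
      moreover have "norm (\<psi> u - y - s *\<^sub>R A w) \<le> \<epsilon> * s"
      proof -
        have "norm (\<psi> u - y - s *\<^sub>R A w) \<le> \<epsilon> / (norm w + 1) * (s * norm w)"
          using \<delta>1(2)[OF u(1)] s by (simp add: u_def hm(1) ch(1) linear_scale[OF lin(1)])
        also have "\<dots> = \<epsilon> * s * (norm w / (norm w + 1))" by simp
        also have "\<dots> \<le> \<epsilon> * s * 1"
          using \<epsilon> s by (intro mult_left_mono) (auto simp: divide_le_eq_1 add_nonneg_pos)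
        finally show ?thesis by simp
      qed
      ultimately show "\<exists>z\<in>Y. norm (z - y - s *\<^sub>R A w) \<le> \<epsilon> * s" by blast
    qed
  qed
  have "analytic_chart_at d Y y U V \<phi> \<psi> L B A"
    unfolding analytic_chart_at_def
    by (intro conjI allI ballI) (fact ch op B lin AB' BA' | rule Y_iff tan, assumption)+
  then show thesis using that by blast
qed

lemma analytic_chart_atD:
  assumes "analytic_chart_at d Y y U V \<phi> \<psi> L B A"
  shows "y \<in> U" "open U" "open V" "homeomorphism U V \<phi> \<psi>" "real_analytic_on \<psi> V"
    "subspace L" "dim L = d" "\<And>z. z \<in> U \<Longrightarrow> z \<in> Y \<longleftrightarrow> \<phi> z \<in> L"
    "strict_derivative \<phi> y B" "linear B" "linear A" "\<And>v. A (B v) = v" "\<And>w. B (A w) = w"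
    "\<And>w. w \<in> L \<Longrightarrow> tangent_at Y y (A w)"
    "\<And>z. z \<in> U \<Longrightarrow> \<psi> (\<phi> z) = z" "\<And>z. z \<in> U \<Longrightarrow> \<phi> z \<in> V"
    "\<And>u. u \<in> V \<Longrightarrow> \<phi> (\<psi> u) = u" "\<And>u. u \<in> V \<Longrightarrow> \<psi> u \<in> U"
    "continuous_on U \<phi>" "continuous_on V \<psi>"
  using assms unfolding analytic_chart_at_def homeomorphism_def by auto

text \<open>Lets escaping be checked on directions in a chart. In a thin cone around the ray, the
  derivative error and the image of the displacement error contribute at most
  \<open>\<eta> / 2 * s\<close> each.\<close>

lemma strict_derivative_along_cone:
  fixes \<phi> :: "'a::euclidean_space \<Rightarrow> 'b::euclidean_space"
  assumes "strict_derivative \<phi> y B" "open U" "y \<in> U" "\<eta> > 0"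
  obtains \<epsilon> where "\<epsilon> > 0" "\<epsilon> \<le> 1"
    "\<And>s z. 0 < s \<Longrightarrow> s < \<epsilon> \<Longrightarrow> norm (z - y - s *\<^sub>R v) < \<epsilon> * s \<Longrightarrow>
       z \<in> U \<and> norm ((1 / s) *\<^sub>R (\<phi> z - \<phi> y) - B v) < \<eta>"
proof -
  have lin: "linear B" using assms(1) by (simp add: strict_derivative_def)
  obtain K where K: "K > 0" "\<And>x. norm (B x) \<le> K * norm x"
    using linear_bounded_pos[OF lin] by blast
  define P where "P = norm v + 1"
  have P: "P > 0" by (simp add: P_def add_nonneg_pos)
  define \<eta>' where "\<eta>' = \<eta> / (2 * P)"
  have "\<eta>' > 0" using P assms(4) by (simp add: \<eta>'_def)
  then obtain \<delta>1 where \<delta>1: "\<delta>1 > 0"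
    "\<And>z. norm (z - y) < \<delta>1 \<Longrightarrow> norm (\<phi> z - \<phi> y - B (z - y)) \<le> \<eta>' * norm (z - y)"
    using strict_derivative_has_derivative[OF assms(1)] unfolding has_derivative_at_alt by blast
  obtain \<delta>2 where \<delta>2: "\<delta>2 > 0" "ball y \<delta>2 \<subseteq> U" using assms(2,3) open_contains_ball by blast
  \<comment> \<open>In turn: the displacement is at most \<open>s * P\<close>; \<open>z\<close>
    stays in \<open>U\<close> and in the range of the derivative estimate;
    \<open>K * \<epsilon>\<close> is at most \<open>\<eta> / 2\<close>.\<close>
  define \<epsilon> where "\<epsilon> = min 1 (min (min \<delta>1 \<delta>2 / P) (\<eta> / (2 * K)))"
  have \<epsilon>: "\<epsilon> > 0" "\<epsilon> \<le> 1" "\<epsilon> \<le> min \<delta>1 \<delta>2 / P" "\<epsilon> \<le> \<eta> / (2 * K)"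
    using \<delta>1 \<delta>2 P K(1) assms(4) by (auto simp: \<epsilon>_def)
  show thesis
  proof (rule that[OF \<epsilon>(1,2)])
    fix s :: real and z assume s: "0 < s" "s < \<epsilon>" "norm (z - y - s *\<^sub>R v) < \<epsilon> * s"
    define e where "e = z - y - s *\<^sub>R v"
    have zy: "z - y = s *\<^sub>R v + e" by (simp add: e_def)
    have "norm (z - y) \<le> s * norm v + norm e" unfolding zy using norm_triangle_ineq[of "s *\<^sub>R v" e] s by simp
    also have "\<dots> \<le> s * norm v + s" using s mult_right_mono[OF \<epsilon>(2), of s] unfolding e_def by linarith
    finally have n: "norm (z - y) \<le> s * P" by (simp add: P_def algebra_simps)
    also have "\<dots> < min \<delta>1 \<delta>2"
    proof -
      have "s < min \<delta>1 \<delta>2 / P" using s(2) \<epsilon>(3) by linarith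
      then show ?thesis using P by (simp only: pos_less_divide_eq)
    qed
    finally have d: "norm (z - y) < \<delta>1" "norm (z - y) < \<delta>2" by auto
    have "z \<in> U" using d(2) \<delta>2(2) by (auto simp: dist_norm norm_minus_commute)
    moreover have "norm ((1 / s) *\<^sub>R (\<phi> z - \<phi> y) - B v) < \<eta>"
    proof -
      have "\<phi> z - \<phi> y - s *\<^sub>R B v = (\<phi> z - \<phi> y - B (z - y)) + B e"
        using lin by (simp add: zy linear_add linear_scale)
      then have "norm (\<phi> z - \<phi> y - s *\<^sub>R B v) \<le> norm (\<phi> z - \<phi> y - B (z - y)) + norm (B e)"
        by (metis norm_triangle_ineq)
      also have "\<dots> \<le> \<eta>' * (s * P) + K * norm e"
        using \<delta>1(2)[OF d(1)] mult_left_mono[OF n, of \<eta>'] K(2)[of e] \<open>\<eta>' > 0\<close> by linarith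
      also have "\<dots> < \<eta>' * (s * P) + K * (\<epsilon> * s)"
        using s(3) K(1) by (simp add: e_def)
      also have "\<dots> \<le> \<eta> / 2 * s + \<eta> / 2 * s"
        using P K(1) \<epsilon>(4) s(1) by (intro add_mono) (auto simp: \<eta>'_def field_simps)
      finally have *: "norm (\<phi> z - \<phi> y - s *\<^sub>R B v) < \<eta> * s" by simp
      have "(1 / s) *\<^sub>R (\<phi> z - \<phi> y) - B v = (1 / s) *\<^sub>R (\<phi> z - \<phi> y - s *\<^sub>R B v)"
        using s(1) by (simp add: scaleR_diff_right)
      then show ?thesis using * s(1) by (simp add: pos_divide_less_eq)
    qed
    ultimately show "z \<in> U \<and> norm ((1 / s) *\<^sub>R (\<phi> z - \<phi> y) - B v) < \<eta>" by blast
  qed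
qed

section \<open>Kinds of sets that \<open>Y\<close> escapes\<close>

lemma escapes_subset:
  assumes "escapes Y C y" "Y \<inter> C' \<subseteq> C"
  shows "escapes Y C' y"
  using assms unfolding escapes_def by (metis IntI IntD1 subsetD)

text \<open>Already the zero vector escapes, because the points of \<open>C\<close> keep a positive
  distance from \<open>y\<close>.\<close>

lemma escapes_outside_closed:
  assumes "closedin (top_of_set Y) C" "y \<in> Y" "y \<notin> C"
  shows "escapes Y C y"
proof -
  have "openin (top_of_set Y) (Y - C)" using assms(1) by (metis openin_diff openin_subtopology_self)
  then obtain e where e: "e > 0" "ball y e \<inter> Y \<subseteq> Y - C"
    using assms(2,3) unfolding openin_contains_ball by blast
  have "tangent_at Y y 0"
    unfolding tangent_at_def using assms(2) by (auto intro!: exI[of _ 1] bexI[of _ y])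
  moreover have "norm (z - y - s *\<^sub>R 0) \<ge> min e 1 * s" if "0 < s" "s < min e 1" "z \<in> Y \<inter> C" for s z
  proof -
    have "norm (z - y) \<ge> e" using e that(3) by (force simp: dist_norm norm_minus_commute)
    moreover have "min e 1 * s \<le> e * 1" using that e(1) by (intro mult_mono) auto
    ultimately show ?thesis by simp
  qed
  ultimately show ?thesis unfolding escapes_def using e(1)
    by (intro exI[of _ 0] conjI exI[of _ "min e 1"]) auto
qed

text \<open>Allows single points to be forbidden, for the sake of uncountability. Any nonzero
  tangent vector \<open>v\<close> works: the only point to avoid is \<open>y\<close>, at distance
  \<open>s * norm v\<close> from \<open>y + s *\<^sub>R v\<close>.\<close>

lemma escapes_singleton:
  fixes Y :: "(real ^ 'n::finite) set"
  assumes "analytic_submanifold d Y" "y \<in> Y" "d > 0"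
  shows "escapes Y {y} y"
proof -
  obtain U V \<phi> \<psi> L B A where "analytic_chart_at d Y y U V \<phi> \<psi> L B A"
    using analytic_chart_exists[OF assms(1,2)] .
  note c = analytic_chart_atD[OF this]
  have "\<not> L \<subseteq> {0}" using c(7) assms(3) dim_eq_0[of L] by auto
  then obtain w where w: "w \<in> L" "w \<noteq> 0" by blast
  have "A w \<noteq> 0" using c(13)[of w] w(2) linear_0[OF c(10)] by auto
  then show ?thesis
    unfolding escapes_def using c(14)[OF w(1)]
    by (intro exI[of _ "A w"] conjI exI[of _ "norm (A w)"]) (auto simp: mult.commute)
qed

text \<open>The injective map \<open>B2 \<circ> A1\<close> cannot send the
  \<open>d\<close>-dimensional \<open>L1\<close> into the \<open>k\<close>-dimensional
  \<open>L2\<close>. A direction sent outside \<open>L2\<close> keeps a positive distance from this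
  closed subspace, whereas points of \<open>R\<close> have chart displacements in
  \<open>L2\<close>.\<close>

lemma escapes_submanifold:
  fixes Y :: "(real ^ 'n::finite) set"
  assumes "analytic_submanifold d Y" "analytic_submanifold k R" "k < d" "y \<in> Y" "y \<in> R"
  shows "escapes Y R y"
proof -
  obtain U1 V1 \<phi>1 \<psi>1 L1 B1 A1 where "analytic_chart_at d Y y U1 V1 \<phi>1 \<psi>1 L1 B1 A1"
    using analytic_chart_exists[OF assms(1,4)] .
  note c1 = analytic_chart_atD[OF this]
  obtain U2 V2 \<phi>2 \<psi>2 L2 B2 A2 where "analytic_chart_at k R y U2 V2 \<phi>2 \<psi>2 L2 B2 A2"
    using analytic_chart_exists[OF assms(2,5)] .
  note c2 = analytic_chart_atD[OF this]
  have "\<not> (B2 \<circ> A1) ` L1 \<subseteq> L2"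
  proof
    assume "(B2 \<circ> A1) ` L1 \<subseteq> L2"
    then have "dim ((B2 \<circ> A1) ` L1) \<le> k" using dim_subset c2(7) by metis
    moreover have "dim ((B2 \<circ> A1) ` L1) = d"
    proof -
      have "inj (B2 \<circ> A1)"
      proof (rule injI)
        fix u u' assume "(B2 \<circ> A1) u = (B2 \<circ> A1) u'"
        then have "B1 (A2 (B2 (A1 u))) = B1 (A2 (B2 (A1 u')))" by simp
        then show "u = u'" by (simp only: c1(13) c2(12))
      qed
      then have "inj_on (B2 \<circ> A1) (span L1)" by (rule inj_on_subset) simp
      from dim_image_eq[OF linear_compose[OF c1(11) c2(10)] this] show ?thesis using c1(7) by simp
    qed
    ultimately show False using assms(3) by simp
  qed
  then obtain w where w: "w \<in> L1" "B2 (A1 w) \<notin> L2" by auto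
  have "open (- L2)" using c2(6) closed_subspace by blast
  then obtain \<eta> where \<eta>: "\<eta> > 0" "ball (B2 (A1 w)) \<eta> \<subseteq> - L2" using w(2) open_contains_ball by blast
  obtain \<epsilon> where \<epsilon>: "\<epsilon> > 0" "\<And>s z. 0 < s \<Longrightarrow> s < \<epsilon> \<Longrightarrow> norm (z - y - s *\<^sub>R A1 w) < \<epsilon> * s \<Longrightarrow>
       z \<in> U2 \<and> norm ((1 / s) *\<^sub>R (\<phi>2 z - \<phi>2 y) - B2 (A1 w)) < \<eta>"
    using strict_derivative_along_cone[OF c2(9,2,1) \<eta>(1)] by metis
  have "norm (z - y - s *\<^sub>R A1 w) \<ge> \<epsilon> * s" if s: "0 < s" "s < \<epsilon>" and z: "z \<in> Y \<inter> R" for s z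
  proof (rule ccontr)
    assume "\<not> norm (z - y - s *\<^sub>R A1 w) \<ge> \<epsilon> * s"
    then have *: "z \<in> U2" "norm ((1 / s) *\<^sub>R (\<phi>2 z - \<phi>2 y) - B2 (A1 w)) < \<eta>"
      using \<epsilon>(2)[OF s, of z] by auto
    have "(1 / s) *\<^sub>R (\<phi>2 z - \<phi>2 y) \<in> L2"
      using c2(1,6) c2(8)[of z] c2(8)[of y] z assms(5) *(1) by (intro subspace_scale subspace_diff) auto
    moreover have "(1 / s) *\<^sub>R (\<phi>2 z - \<phi>2 y) \<in> ball (B2 (A1 w)) \<eta>"
      using *(2) by (simp add: dist_norm norm_minus_commute)
    ultimately show False using \<eta>(2) by blast
  qed
  then show ?thesis unfolding escapes_def using c1(14)[OF w(1)] \<epsilon>(1) by blast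
qed

text \<open>A first-order argument is not enough, as \<open>Y\<close> may be tangent to the
  hyperplane. If the lowest part that is nonzero on \<open>L\<close> has degree \<open>j\<close>, a
  solution at \<open>s *\<^sub>R \<omega>\<close> with \<open>\<omega>\<close> near
  \<open>w0\<close> would need a term of size at least \<open>\<beta> * s ^ j\<close> to be
  cancelled by a tail of size at most \<open>D * s ^ Suc j\<close>.\<close>

lemma escapes_hyperplane_or_locally_contained:
  fixes Y :: "(real ^ 'n::finite) set"
  assumes "analytic_submanifold d Y" "y \<in> Y" "a \<bullet> y = c"
  shows "escapes Y {z. a \<bullet> z = c} y \<or> (\<exists>\<delta>>0. Y \<inter> ball y \<delta> \<subseteq> {z. a \<bullet> z = c})"
proof -
  obtain U V \<phi> \<psi> L B A where "analytic_chart_at d Y y U V \<phi> \<psi> L B A"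
    using analytic_chart_exists[OF assms(1,2)] .
  note c = analytic_chart_atD[OF this]
  obtain r q0 M0 K where r: "r > 0" and hs0: "homogeneous_series q0 M0 K"
      and sums0: "\<And>w. norm w < r \<Longrightarrow> (\<lambda>j. q0 j w) sums \<psi> (\<phi> y + w)"
    using real_analytic_on_expansion[OF c(5) c(16)[OF c(1)]] by metis
  define q where "q j w = a \<bullet> q0 j w - (if j = 0 then c else 0)" for j w
  obtain M where hs: "homogeneous_series q M K"
    unfolding q_def using homogeneous_series_inner[OF hs0] by blast
  note h = homogeneous_seriesD[OF hs]
  have sums: "(\<lambda>j. q j w) sums (a \<bullet> \<psi> (\<phi> y + w) - c)" if "norm w < r" for w
  proof -
    have "(\<lambda>j. a \<bullet> q0 j w) sums (a \<bullet> \<psi> (\<phi> y + w))"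
      using sums0[OF that] by (rule bounded_linear.sums[OF bounded_linear_inner_right])
    moreover have "(\<lambda>j::nat. if j = 0 then c else 0) sums c"
      using sums_single[of 0 "\<lambda>_. c"] by simp
    ultimately show ?thesis unfolding q_def by (rule sums_diff)
  qed
  show ?thesis
  proof (cases "\<forall>j. \<forall>w\<in>L. q j w = 0")
    case True
    have "open (U \<inter> \<phi> -` ball (\<phi> y) r)"
      using c(2,19) by (intro continuous_open_preimage) auto
    moreover have "y \<in> U \<inter> \<phi> -` ball (\<phi> y) r" using c(1) r by simp
    ultimately obtain \<delta> where \<delta>: "\<delta> > 0" "ball y \<delta> \<subseteq> U \<inter> \<phi> -` ball (\<phi> y) r" by (rule openE)
    have "a \<bullet> z = c" if z: "z \<in> Y \<inter> ball y \<delta>" for z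
    proof -
      have zU: "z \<in> U" "norm (\<phi> z - \<phi> y) < r" using z \<delta>(2) by (auto simp: dist_norm norm_minus_commute)
      have "\<phi> z - \<phi> y \<in> L" using zU c(1,6) c(8)[of z] c(8)[of y] z assms(2) by (intro subspace_diff) auto
      then have "(\<lambda>j::nat. 0) sums (a \<bullet> \<psi> (\<phi> y + (\<phi> z - \<phi> y)) - c)"
        using sums[OF zU(2)] True by simp
      then have "a \<bullet> \<psi> (\<phi> y + (\<phi> z - \<phi> y)) - c = 0" using sums_unique2 sums_zero by blast
      then show ?thesis using c(15)[OF zU(1)] by simp
    qed
    then show ?thesis using \<delta>(1) by blast
  next
    case False
    define j where "j = (LEAST j. \<exists>w\<in>L. q j w \<noteq> 0)"
    have "\<exists>w\<in>L. q j w \<noteq> 0" unfolding j_def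
      by (rule LeastI_ex[of "\<lambda>j. \<exists>w\<in>L. q j w \<noteq> 0"]) (use False in blast)
    then obtain w0 where w0: "w0 \<in> L" "q j w0 \<noteq> 0" by blast
    have lower: "q i w = 0" if "i < j" "w \<in> L" for i w
      using not_less_Least[of i "\<lambda>j. \<exists>w\<in>L. q j w \<noteq> 0"] that unfolding j_def by blast
    define \<beta> where "\<beta> = \<bar>q j w0\<bar> / 2"
    have \<beta>: "\<beta> > 0" using w0 by (simp add: \<beta>_def)
    obtain \<eta>0 where \<eta>0: "\<eta>0 > 0" "\<And>\<omega>. dist \<omega> w0 < \<eta>0 \<Longrightarrow> dist (q j \<omega>) (q j w0) < \<beta>"
      using homogeneous_series_continuous[OF hs, of w0 j] \<beta> unfolding continuous_at_eps_delta by blast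
    \<comment> \<open>The cap 1 ensures \<open>norm \<omega> \<le> P\<close> below.\<close>
    define \<eta> where "\<eta> = min \<eta>0 1"
    have \<eta>: "\<eta> > 0" using \<eta>0 by (simp add: \<eta>_def)
    have qlow: "\<bar>q j \<omega>\<bar> \<ge> \<beta>" if "norm (\<omega> - w0) < \<eta>" for \<omega>
      using \<eta>0(2)[of \<omega>] that unfolding \<eta>_def \<beta>_def dist_norm real_norm_def by (simp, arith)
    obtain \<epsilon>1 where \<epsilon>1: "\<epsilon>1 > 0" "\<And>s z. 0 < s \<Longrightarrow> s < \<epsilon>1 \<Longrightarrow> norm (z - y - s *\<^sub>R A w0) < \<epsilon>1 * s \<Longrightarrow>
       z \<in> U \<and> norm ((1 / s) *\<^sub>R (\<phi> z - \<phi> y) - B (A w0)) < \<eta>"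
      using strict_derivative_along_cone[OF c(9,2,1) \<eta>] by metis
    define P where "P = norm w0 + 1"
    have P: "P > 0" by (simp add: P_def add_nonneg_pos)
    define D where "D = 2 * M * (K * P) ^ Suc j"
    have D: "D > 0" using h(1,2) P by (simp add: D_def)
    \<comment> \<open>Besides the cone estimate: convergence of the expansion, the ratio 1/2 for the
      tail estimate, and \<open>s * D < \<beta>\<close>.\<close>
    define \<epsilon> where "\<epsilon> = min (min \<epsilon>1 (r / P)) (min (1 / (2 * K * P)) (\<beta> / D))"
    have \<epsilon>: "\<epsilon> > 0" "\<epsilon> \<le> \<epsilon>1" "\<epsilon> \<le> r / P" "\<epsilon> \<le> 1 / (2 * K * P)" "\<epsilon> \<le> \<beta> / D"
      using \<epsilon>1(1) r P h(2) \<beta> D by (auto simp: \<epsilon>_def)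
    have "norm (z - y - s *\<^sub>R A w0) \<ge> \<epsilon> * s"
      if s: "0 < s" "s < \<epsilon>" and z: "z \<in> Y \<inter> {z. a \<bullet> z = c}" for s z
    proof (rule ccontr)
      define \<omega> where "\<omega> = (1 / s) *\<^sub>R (\<phi> z - \<phi> y)"
      assume "\<not> norm (z - y - s *\<^sub>R A w0) \<ge> \<epsilon> * s"
      then have "norm (z - y - s *\<^sub>R A w0) < \<epsilon>1 * s"
        using mult_right_mono[OF \<epsilon>(2), of s] s(1) by linarith
      then have zU: "z \<in> U" and \<omega>: "norm (\<omega> - w0) < \<eta>"
        using \<epsilon>1(2)[of s z] s \<epsilon>(2) c(13) by (auto simp: \<omega>_def)
      have \<omega>L: "\<omega> \<in> L" unfolding \<omega>_def
        using zU c(1,6) c(8)[of z] c(8)[of y] z assms(2) by (intro subspace_scale subspace_diff) auto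
      have \<phi>z: "\<phi> z = \<phi> y + s *\<^sub>R \<omega>" using s(1) by (simp add: \<omega>_def)
      have "norm \<omega> \<le> P" using norm_triangle_sub[of \<omega> w0] \<omega> by (simp add: P_def \<eta>_def)
      then have n: "norm (s *\<^sub>R \<omega>) \<le> s * P" using s(1) by simp
      have "s < r / P" "s < 1 / (2 * K * P)" using s(2) \<epsilon>(3,4) by linarith+
      moreover have "2 * K * P > 0" using P h(2) by simp
      ultimately have sP: "s * P < r" "s * (2 * K * P) < 1" using P by (simp_all only: pos_less_divide_eq)
      have "K * norm (s *\<^sub>R \<omega>) \<le> K * (s * P)" using n h(2) by (intro mult_left_mono) auto
      then have small: "norm (s *\<^sub>R \<omega>) < r" "K * norm (s *\<^sub>R \<omega>) \<le> 1 / 2"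
        using n sP by (linarith, simp add: mult_ac)
      have "(\<lambda>i. q i (s *\<^sub>R \<omega>)) sums 0"
        using sums[OF small(1)] z c(15)[OF zU] by (simp flip: \<phi>z)
      then have "norm (q j (s *\<^sub>R \<omega>)) \<le> 2 * M * (K * norm (s *\<^sub>R \<omega>)) ^ Suc j"
        using lower \<omega>L c(6) small(2) by (intro homogeneous_series_tail_le[OF hs]) (auto simp: subspace_scale)
      also have "\<dots> \<le> 2 * M * (K * (s * P)) ^ Suc j"
        using n h(1,2) by (intro mult_left_mono power_mono) auto
      also have "\<dots> = s ^ j * (s * D)" by (simp add: D_def power_mult_distrib mult_ac)
      finally have "s ^ j * \<bar>q j \<omega>\<bar> \<le> s ^ j * (s * D)" using s(1) by (simp add: h(4) abs_mult)
      then have "\<bar>q j \<omega>\<bar> \<le> s * D" using s(1) by simp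
      also have "\<dots> < \<beta>"
      proof -
        have "s < \<beta> / D" using s(2) \<epsilon>(5) by linarith
        then show ?thesis using D by (simp only: pos_less_divide_eq)
      qed
      finally show False using qlow[OF \<omega>] by simp
    qed
    then have "escapes Y {z. a \<bullet> z = c} y"
      unfolding escapes_def using c(14)[OF w0(1)] \<epsilon>(1) by blast
    then show ?thesis ..
  qed
qed

text \<open>Local containment in the hyperplane is an open condition on points of \<open>Y\<close>
  by its form, and a closed one by the identity theorem in a slice chart at a limit point. By
  connectedness, one such point would put all of \<open>Y\<close> into the hyperplane.\<close>

lemma escapes_hyperplane:
  fixes Y :: "(real ^ 'n::finite) set"
  assumes Y: "analytic_submanifold d Y" "connected Y" and y: "y \<in> Y" "a \<bullet> y = c"
    and nsub: "\<not> Y \<subseteq> {z. a \<bullet> z = c}"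
  shows "escapes Y {z. a \<bullet> z = c} y"
proof (rule ccontr)
  assume "\<not> escapes Y {z. a \<bullet> z = c} y"
  then have loc: "\<exists>\<delta>>0. Y \<inter> ball y \<delta> \<subseteq> {z. a \<bullet> z = c}"
    using escapes_hyperplane_or_locally_contained[OF Y(1) y] by blast
  define Z where "Z = {y\<in>Y. \<exists>\<delta>>0. Y \<inter> ball y \<delta> \<subseteq> {z. a \<bullet> z = c}}"
  have "openin (top_of_set Y) Z"
    unfolding openin_euclidean_subtopology_iff
  proof (intro conjI ballI)
    show "Z \<subseteq> Y" by (auto simp: Z_def)
    fix z assume "z \<in> Z"
    then obtain \<delta> where \<delta>: "\<delta> > 0" "Y \<inter> ball z \<delta> \<subseteq> {z. a \<bullet> z = c}" by (auto simp: Z_def)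
    have "z' \<in> Z" if "z' \<in> Y" "dist z' z < \<delta> / 2" for z'
    proof -
      have "ball z' (\<delta> / 2) \<subseteq> ball z \<delta>"
      proof
        fix x assume "x \<in> ball z' (\<delta> / 2)"
        then show "x \<in> ball z \<delta>"
          using that(2) dist_triangle[of z x z'] by (simp add: dist_commute)
      qed
      then show ?thesis using that(1) \<delta> by (auto simp: Z_def intro!: exI[of _ "\<delta> / 2"])
    qed
    then show "\<exists>e>0. \<forall>z'\<in>Y. dist z' z < e \<longrightarrow> z' \<in> Z" using \<delta>(1) by (intro exI[of _ "\<delta> / 2"]) auto
  qed
  moreover have "closedin (top_of_set Y) Z"
    unfolding closedin_limpt
  proof (intro conjI allI impI)
    show "Z \<subseteq> Y" by (auto simp: Z_def)
    fix x assume x: "x islimpt Z \<and> x \<in> Y"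
    obtain U V \<phi> \<psi> L B A where "analytic_chart_at d Y x U V \<phi> \<psi> L B A"
      using analytic_chart_exists[OF Y(1)] x by blast
    note ch = analytic_chart_atD[OF this]
    obtain r where r: "r > 0" "ball (\<phi> x) r \<subseteq> V" using ch(1,3,16) open_contains_ball by blast
    \<comment> \<open>A convex piece of the slice, on which the identity theorem carries the
      equation from a neighbourhood of \<open>\<phi> z1\<close> to every point.\<close>
    define D where "D = ball (\<phi> x) r \<inter> L"
    have D: "convex D" "D \<subseteq> V" using r(2) convex_Int[OF convex_ball subspace_imp_convex[OF ch(6)]] by (auto simp: D_def)
    have "open (U \<inter> \<phi> -` ball (\<phi> x) r)"
      using ch(2,19) by (intro continuous_open_preimage) auto
    moreover have "x \<in> U \<inter> \<phi> -` ball (\<phi> x) r" using ch(1) r by simp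
    ultimately obtain e where e: "e > 0" "ball x e \<subseteq> U \<inter> \<phi> -` ball (\<phi> x) r" by (rule openE)
    have mapD: "z \<in> U \<and> \<phi> z \<in> D" if "z \<in> Y" "dist z x < e" for z
      using that e(2) ch(8)[of z] by (auto simp: D_def dist_commute subset_iff)
    obtain z1 where z1: "z1 \<in> Z" "dist z1 x < e" using x e(1) unfolding islimpt_approachable by blast
    obtain \<delta>1 where \<delta>1: "\<delta>1 > 0" "Y \<inter> ball z1 \<delta>1 \<subseteq> {z. a \<bullet> z = c}" "z1 \<in> Y"
      using z1(1) by (auto simp: Z_def)
    have z1D: "z1 \<in> U" "\<phi> z1 \<in> D" using mapD[OF \<delta>1(3) z1(2)] by auto
    have "open (V \<inter> \<psi> -` ball z1 \<delta>1)"
      using ch(3,20) by (intro continuous_open_preimage) auto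
    moreover have "\<phi> z1 \<in> V \<inter> \<psi> -` ball z1 \<delta>1" using z1D D(2) \<delta>1(1) ch(15) by auto
    ultimately obtain \<delta> where \<delta>: "\<delta> > 0" "ball (\<phi> z1) \<delta> \<subseteq> V \<inter> \<psi> -` ball z1 \<delta>1"
      by (rule openE)
    have "a \<bullet> \<psi> u = c" if "u \<in> ball (\<phi> z1) \<delta> \<inter> D" for u
    proof -
      have "\<psi> u \<in> Y" using that ch(8)[of "\<psi> u"] ch(17,18) D(2) by (auto simp: D_def)
      then show ?thesis using that \<delta>(2) \<delta>1(2) by blast
    qed
    then have all: "a \<bullet> \<psi> w = c" if "w \<in> D" for w
      using real_analytic_on_convex_identity[OF ch(5) D z1D(2) \<delta>(1) _ that] by blast
    have "a \<bullet> z = c" if "z \<in> Y" "dist z x < e" for z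
      using all[of "\<phi> z"] mapD[OF that] ch(15) by auto
    then show "x \<in> Z" using x e(1) by (auto simp: Z_def dist_commute intro!: exI[of _ e])
  qed
  moreover have "y \<in> Z" using loc y(1) by (simp add: Z_def)
  ultimately have "Z = Y" using Y(2) connected_clopen by blast
  then show False using nsub unfolding Z_def by force
qed

section \<open>Coordinate graphs and the construction on the manifold\<close>

definition coord_proj :: "'n set \<Rightarrow> real ^ 'n::finite \<Rightarrow> real ^ 'n" where
  "coord_proj I x = (\<chi> i. if i \<in> I then x $ i else 0)"

lemma linear_coord_proj: "linear (coord_proj I)"
  by (intro linearI) (auto simp: coord_proj_def vec_eq_iff)

lemma coord_proj_in_coord_space: "coord_proj I x \<in> coord_space I"
  by (simp add: coord_proj_def coord_space_def)

lemma coord_proj_nth: "i \<in> I \<Longrightarrow> coord_proj I x $ i = x $ i"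
  by (simp add: coord_proj_def)

lemma norm_coord_proj_le: "norm (coord_proj I x) \<le> norm x"
  unfolding norm_vec_def by (rule L2_set_mono) (auto simp: coord_proj_def)

lemma in_span_axis:
  fixes v :: "real ^ 'n::finite"
  assumes "v \<in> coord_space I"
  shows "v \<in> span ((\<lambda>i. axis i 1) ` I)"
proof -
  have "v = (\<Sum>i\<in>UNIV. v $ i *\<^sub>R axis i 1)"
    by (simp add: vec_eq_iff axis_def if_distrib sum.If_cases cong: if_cong)
  also have "\<dots> = (\<Sum>i\<in>I. v $ i *\<^sub>R axis i 1)"
    using assms by (intro sum.mono_neutral_right) (auto simp: coord_space_def)
  finally show ?thesis by (metis (no_types, lifting) imageI span_base span_scale span_sum)
qed

lemma dim_coord_space_le: "dim (coord_space (I :: 'n::finite set)) \<le> card I"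
proof -
  have "dim (coord_space I) \<le> card ((\<lambda>i. axis i (1::real) :: real ^ 'n) ` I)"
    by (rule dim_le_card) (auto intro: in_span_axis)
  also have "\<dots> \<le> card I" by (rule card_image_le) simp
  finally show ?thesis .
qed

text \<open>Steinitz exchange: a basis of \<open>T\<close> is completed by standard basis vectors.
  These span the kernel of the projection to the remaining coordinates, and that span meets
  \<open>T\<close> trivially.\<close>

lemma coord_proj_injective_on_subspace:
  fixes T :: "(real ^ 'n::finite) set"
  assumes "subspace T"
  obtains I where "card I = dim T" "\<And>v. v \<in> T \<Longrightarrow> coord_proj I v = 0 \<Longrightarrow> v = 0"
proof -
  obtain B0 where B0: "B0 \<subseteq> T" "independent B0" "T \<subseteq> span B0" "card B0 = dim T"
    using basis_exists by blast
  obtain B where B: "B0 \<subseteq> B" "B \<subseteq> B0 \<union> Basis" "independent B" "B0 \<union> Basis \<subseteq> span B"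
    using maximal_independent_subset_extend[of B0 "B0 \<union> Basis"] B0(2) by blast
  have finB: "finite B" using B(3) independent_imp_finite by blast
  have "span (Basis :: (real ^ 'n) set) \<subseteq> span B" using B(4) by (intro span_minimal) auto
  then have spanB: "span B = UNIV" by auto
  define N where "N = B - B0"
  have cardB: "card B = CARD('n)"
    using B(3) spanB dim_eq_card_independent[OF B(3)] dim_span[of B] by simp
  have cardN: "card N = CARD('n) - dim T"
    unfolding N_def using cardB B0(4) B(1) finB by (simp add: card_Diff_subset finite_subset)
  have "dim T \<le> CARD('n)" using dim_subset_UNIV[of T] by simp
  have "dim {x + y |x y. x \<in> span B0 \<and> y \<in> span N} + dim (span B0 \<inter> span N) = dim (span B0) + dim (span N)"
    by (rule dim_sums_Int) auto
  moreover have "{x + y |x y. x \<in> span B0 \<and> y \<in> span N} = span (B0 \<union> N)"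
    by (auto simp: span_Un)
  moreover have "B0 \<union> N = B" using B(1) by (auto simp: N_def)
  moreover have "independent N" using B(3) independent_mono unfolding N_def by blast
  ultimately have "dim (span B0 \<inter> span N) = 0"
    using spanB cardB cardN B0(2,4) \<open>dim T \<le> CARD('n)\<close>
    by (simp add: dim_eq_card_independent)
  then have triv: "span B0 \<inter> span N \<subseteq> {0}" by (simp only: dim_eq_0)
  define J where "J = {j. axis j (1::real) \<in> N}"
  have NJ: "N = (\<lambda>j. axis j 1) ` J"
    using B(2) by (auto simp: N_def J_def Basis_vec_def)
  have "card N = card J"
    unfolding NJ by (intro card_image inj_onI) (simp add: axis_eq_axis)
  then have cJ: "card (- J) = dim T"
    using cardN \<open>dim T \<le> CARD('n)\<close> by (simp add: Compl_eq_Diff_UNIV card_Diff_subset)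
  have "v = 0" if "v \<in> T" "coord_proj (- J) v = 0" for v
  proof -
    have "v \<in> coord_space J"
      using that(2) by (auto simp: coord_space_def coord_proj_def vec_eq_iff split: if_splits)
    then have "v \<in> span N" unfolding NJ by (rule in_span_axis)
    then show ?thesis using that(1) B0(3) triv by blast
  qed
  then show thesis using that cJ by blast
qed

text \<open>A suitable coordinate projection is bounded below on the tangent space \<open>T\<close>;
  by strict differentiability the secants of \<open>Y\<close> near \<open>y\<close> are close to
  \<open>T\<close>, so it is bounded below on them too. The image is open by invariance of domain,
  the coordinate plane having no larger dimension than \<open>L\<close>.\<close>

lemma local_coordinate_graph:
  fixes Y :: "(real ^ 'n::finite) set"
  assumes "analytic_submanifold d Y" "y \<in> Y" "open W0" "y \<in> W0"
  obtains I W \<kappa> where "card I = d" "open W" "y \<in> W" "W \<subseteq> W0" "\<kappa> > 0"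
    "openin (top_of_set (coord_space I)) (coord_proj I ` (Y \<inter> W))"
    "\<And>z1 z2. z1 \<in> Y \<inter> W \<Longrightarrow> z2 \<in> Y \<inter> W \<Longrightarrow> norm (z1 - z2) \<le> \<kappa> * norm (coord_proj I (z1 - z2))"
proof -
  obtain U V \<phi> \<psi> L B A where "analytic_chart_at d Y y U V \<phi> \<psi> L B A"
    using analytic_chart_exists[OF assms(1,2)] .
  note c = analytic_chart_atD[OF this]
  define T where "T = A ` L"
  have subT: "subspace T" unfolding T_def using c(6,11) linear_subspace_image by blast
  have "inj A" using c(13) by (metis injI)
  then have dimT: "dim T = d"
    unfolding T_def using dim_image_eq[OF c(11), of L] c(7) by (simp add: inj_on_subset)
  obtain I where I: "card I = d" "\<And>v. v \<in> T \<Longrightarrow> coord_proj I v = 0 \<Longrightarrow> v = 0"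
    using coord_proj_injective_on_subspace[OF subT] dimT by metis
  let ?p = "coord_proj I"
  have "\<exists>e>0. \<forall>x\<in>T. norm (?p x) \<ge> e * norm x"
    using I(2) subT linear_coord_proj
    by (intro injective_imp_isometric closed_subspace) (auto simp: linear_conv_bounded_linear)
  then obtain e where e: "e > 0" "\<And>x. x \<in> T \<Longrightarrow> norm (?p x) \<ge> e * norm x" by blast
  define k where "k = 1 / e"
  have k: "k > 0" "\<And>x. x \<in> T \<Longrightarrow> norm x \<le> k * norm (?p x)"
    using e by (auto simp: k_def field_simps)
  obtain K where K: "K > 0" "\<And>x. norm (A x) \<le> K * norm x"
    using linear_bounded_pos[OF c(11)] by blast
  \<comment> \<open>Makes \<open>(k + 1) * norm (v - h)\<close> at most \<open>norm h / 2\<close>,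
    which the left side of the final estimate absorbs; this doubles \<open>k\<close> to
    \<open>\<kappa>\<close>.\<close>
  define \<eta> where "\<eta> = 1 / (2 * K * (k + 1))"
  have \<eta>: "\<eta> > 0" using K k by (simp add: \<eta>_def)
  obtain \<delta> where \<delta>: "\<delta> > 0" "\<And>z1 z2. z1 \<in> ball y \<delta> \<Longrightarrow> z2 \<in> ball y \<delta> \<Longrightarrow>
      norm (\<phi> z1 - \<phi> z2 - B (z1 - z2)) \<le> \<eta> * norm (z1 - z2)"
    using c(9) \<eta> unfolding strict_derivative_def by metis
  define W where "W = U \<inter> W0 \<inter> ball y \<delta>"
  have W: "open W" "y \<in> W" "W \<subseteq> W0" "W \<subseteq> U" using c(1,2) assms(3,4) \<delta>(1) by (auto simp: W_def)
  define \<kappa> where "\<kappa> = 2 * k"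
  have \<kappa>: "\<kappa> > 0" using k by (simp add: \<kappa>_def)
  have lower: "norm (z1 - z2) \<le> \<kappa> * norm (?p (z1 - z2))" if z: "z1 \<in> Y \<inter> W" "z2 \<in> Y \<inter> W" for z1 z2
  proof -
    define h where "h = z1 - z2"
    \<comment> \<open>The tangent vector with which the secant \<open>h\<close> is compared.\<close>
    define v where "v = A (\<phi> z1 - \<phi> z2)"
    have "\<phi> z1 - \<phi> z2 \<in> L"
      using z W(4) c(8)[of z1] c(8)[of z2] by (intro subspace_diff c(6)) auto
    then have vT: "v \<in> T" by (simp add: v_def T_def)
    have "v - h = A (\<phi> z1 - \<phi> z2 - B h)" by (simp add: v_def linear_diff[OF c(11)] c(12))
    then have "norm (v - h) \<le> K * norm (\<phi> z1 - \<phi> z2 - B h)" using K(2) by metis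
    also have "\<dots> \<le> K * (\<eta> * norm h)"
      using z \<delta>(2)[of z1 z2] K(1) by (intro mult_left_mono) (auto simp: W_def h_def)
    finally have "(k + 1) * norm (v - h) \<le> (k + 1) * (K * (\<eta> * norm h))"
      using k(1) by (intro mult_left_mono) auto
    also have "\<dots> = norm h / 2" using K(1) k(1) by (simp add: \<eta>_def divide_simps)
    finally have vh: "(k + 1) * norm (v - h) \<le> norm h / 2" .
    have "norm h \<le> norm v + norm (v - h)" by (metis norm_triangle_sub norm_minus_commute)
    also have "norm v \<le> k * norm (?p v)" using k(2)[OF vT] .
    also have "?p v = ?p h + ?p (v - h)" by (simp add: linear_diff[OF linear_coord_proj])
    also have "norm (?p h + ?p (v - h)) \<le> norm (?p h) + norm (v - h)"
      using norm_triangle_ineq[of "?p h" "?p (v - h)"] norm_coord_proj_le[of I "v - h"] by linarith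
    finally have "norm h \<le> k * (norm (?p h) + norm (v - h)) + norm (v - h)"
      using k(1) by (simp add: mult_left_mono)
    then show ?thesis using vh by (simp add: h_def \<kappa>_def algebra_simps)
  qed
  have inj: "inj_on ?p (Y \<inter> W)"
  proof (rule inj_onI)
    fix z1 z2 assume z: "z1 \<in> Y \<inter> W" "z2 \<in> Y \<inter> W" "?p z1 = ?p z2"
    then show "z1 = z2" using lower[OF z(1,2)] by (simp add: linear_diff[OF linear_coord_proj])
  qed
  define S where "S = L \<inter> (V \<inter> \<psi> -` W)"
  have "open (V \<inter> \<psi> -` W)" using c(3,20) W(1) by (intro continuous_open_preimage)
  then have opS: "openin (top_of_set L) S" unfolding S_def by (rule openin_open_Int)
  have "\<psi> ` S = Y \<inter> W"
  proof
    show "\<psi> ` S \<subseteq> Y \<inter> W" using c(8) c(17,18) by (auto simp: S_def)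
    show "Y \<inter> W \<subseteq> \<psi> ` S"
    proof
      fix z assume z: "z \<in> Y \<inter> W"
      then have "\<phi> z \<in> S" using W(4) c(8)[of z] c(15,16) by (auto simp: S_def)
      then show "z \<in> \<psi> ` S" using z W(4) c(15)[of z] by (metis IntD2 image_eqI subsetD)
    qed
  qed
  then have img: "(?p \<circ> \<psi>) ` S = ?p ` (Y \<inter> W)" by (metis image_comp)
  have "openin (top_of_set (coord_space I)) ((?p \<circ> \<psi>) ` S)"
  proof (rule invariance_of_domain_subspaces[OF opS c(6) subspace_coord_space])
    show "dim (coord_space I) \<le> dim L" using dim_coord_space_le[of I] I(1) c(7) by simp
    show "continuous_on S (?p \<circ> \<psi>)"
      using c(20) linear_continuous_on linear_coord_proj
      by (intro continuous_on_compose) (auto simp: S_def linear_conv_bounded_linear intro: continuous_on_subset)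
    show "?p \<circ> \<psi> \<in> S \<rightarrow> coord_space I" using coord_proj_in_coord_space by auto
    show "inj_on (?p \<circ> \<psi>) S"
    proof (rule comp_inj_on)
      show "inj_on \<psi> S" using c(17) by (intro inj_on_inverseI[of _ \<phi>]) (auto simp: S_def)
      show "inj_on ?p (\<psi> ` S)" using inj \<open>\<psi> ` S = Y \<inter> W\<close> by simp
    qed
  qed
  then show thesis using that[OF I(1) W(1-3) \<kappa>] img lower by simp
qed

text \<open>The escaping tangent vector \<open>v\<close> need not have a rational projection, but a
  rational \<open>v'\<close> near the projection works: the Lipschitz bound keeps
  \<open>g (x + s *\<^sub>R v')\<close> within \<open>\<epsilon> * s\<close> of
  \<open>g x + s *\<^sub>R v\<close>, where no point of the forbidden set lies.\<close>

lemma approximable_avoiding_escaped: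
  fixes Y :: "(real ^ 'n::finite) set"
  assumes Y: "analytic_submanifold d Y" "y \<in> Y" and W0: "open W0" "y \<in> W0"
    and \<C>: "countable \<C>" "\<And>C. C \<in> \<C> \<Longrightarrow> closedin (top_of_set Y) C"
      "\<And>C z. C \<in> \<C> \<Longrightarrow> z \<in> Y \<Longrightarrow> escapes Y C z"
    and fpos: "\<And>t. t > 0 \<Longrightarrow> f t > 0" and anti: "antimono_on {0<..} f"
    and lim: "filterlim (\<lambda>t. t powr (1 / (real CARD('n) - real d + 1)) * f t) at_top at_top"
  shows "\<exists>z\<in>Y \<inter> W0. z \<in> UA f \<and> z \<notin> \<Union>\<C>"
proof -
  obtain I W \<kappa> where IW: "card I = d" "open W" "y \<in> W" "W \<subseteq> W0" "\<kappa> > 0"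
    "openin (top_of_set (coord_space I)) (coord_proj I ` (Y \<inter> W))"
    and lower: "\<And>z1 z2. z1 \<in> Y \<inter> W \<Longrightarrow> z2 \<in> Y \<inter> W \<Longrightarrow> norm (z1 - z2) \<le> \<kappa> * norm (coord_proj I (z1 - z2))"
    using local_coordinate_graph[OF Y W0] by metis
  let ?p = "coord_proj I"
  define \<Omega> where "\<Omega> = ?p ` (Y \<inter> W)"
  define g where "g = the_inv_into (Y \<inter> W) ?p"
  have inj: "inj_on ?p (Y \<inter> W)"
  proof (rule inj_onI)
    fix z1 z2 assume z: "z1 \<in> Y \<inter> W" "z2 \<in> Y \<inter> W" "?p z1 = ?p z2"
    then show "z1 = z2" using lower[OF z(1,2)] by (simp add: linear_diff[OF linear_coord_proj])
  qed
  have g: "g u \<in> Y \<inter> W" "?p (g u) = u" if "u \<in> \<Omega>" for u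
    using that the_inv_into_into[OF inj, of u] f_the_inv_into_f[OF inj, of u]
    by (auto simp: g_def \<Omega>_def)
  have glip: "norm (g u - g u') \<le> \<kappa> * norm (u - u')" if "u \<in> \<Omega>" "u' \<in> \<Omega>" for u u'
    using lower[OF g(1)[OF that(1)] g(1)[OF that(2)]] g(2) that by (simp add: linear_diff[OF linear_coord_proj])
  have "\<kappa>-lipschitz_on \<Omega> g" using glip IW(5) by (intro lipschitz_onI) (auto simp: dist_norm)
  then have gcont: "continuous_on \<Omega> g" by (rule lipschitz_on_continuous_on)
  \<comment> \<open>The empty set is inserted to have a nonempty family to enumerate; it is escaped
    trivially.\<close>
  define C where "C = from_nat_into (insert {} \<C>)"
  have rangeC: "range C = insert {} \<C>"
    unfolding C_def using \<C>(1) by (intro range_from_nat_into) auto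
  have Ccl: "closedin (top_of_set Y) (C l)" for l
    using rangeC \<C>(2) by (metis closedin_empty insertE rangeI)
  have Cesc: "escapes Y (C l) z" if "z \<in> Y" for l z
  proof (cases "C l \<in> \<C>")
    case False
    then have "C l = {}" using rangeC by (metis insertE rangeI)
    then show ?thesis using Ccl[of l] that by (intro escapes_outside_closed) auto
  qed (use \<C>(3) that in blast)
  have "\<exists>u\<in>\<Omega>. g u \<in> UA f \<and> (\<forall>l. g u \<notin> C l)"
  proof (rule nested_rational_lines[where I = I])
    show "openin (top_of_set (coord_space I)) \<Omega>" using IW(6) by (simp add: \<Omega>_def)
    show "\<Omega> \<noteq> {}" using IW(3) Y(2) by (auto simp: \<Omega>_def)
    show "continuous_on \<Omega> g" by fact
    show "g u $ i = u $ i" if "u \<in> \<Omega>" "i \<in> I" for u i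
      using coord_proj_nth[OF that(2), of "g u"] g(2)[OF that(1)] by simp
    show "closedin (top_of_set \<Omega>) {u \<in> \<Omega>. g u \<in> C l}" for l
    proof -
      have "g \<in> \<Omega> \<rightarrow> Y" using g(1) by auto
      from continuous_closedin_preimage_gen[OF gcont this Ccl[of l]] show ?thesis
        by (simp add: Collect_conj_eq vimage_def)
    qed
    show "f t > 0" if "t > 0" for t using fpos that .
    show "antimono_on {0<..} f" by fact
    have "card (- I) = CARD('n) - d" "d \<le> CARD('n)"
      using IW(1) card_mono[of UNIV I] by (auto simp: Compl_eq_Diff_UNIV card_Diff_subset)
    then have exponent: "real (Suc (card (- I))) = real CARD('n) - real d + 1" by (simp add: of_nat_diff)
    show "filterlim (\<lambda>t. t powr (1 / real (Suc (card (- I)))) * f t) at_top at_top"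
      unfolding exponent by (rule lim)
    show "\<exists>v\<in>coord_space I. rational_vec v \<and>
        (\<exists>\<epsilon>>0. \<forall>s. 0 < s \<and> s < \<epsilon> \<and> x + s *\<^sub>R v \<in> \<Omega> \<longrightarrow> g (x + s *\<^sub>R v) \<notin> C l)"
      if x: "x \<in> \<Omega>" for x l
    proof -
      have gx: "g x \<in> Y" "g x \<in> W" using g(1)[OF x] by auto
      obtain v \<epsilon> where tan: "tangent_at Y (g x) v" and \<epsilon>: "\<epsilon> > 0"
        "\<And>s z. 0 < s \<Longrightarrow> s < \<epsilon> \<Longrightarrow> z \<in> Y \<inter> C l \<Longrightarrow> norm (z - g x - s *\<^sub>R v) \<ge> \<epsilon> * s"
        using Cesc[OF gx(1), of l] unfolding escapes_def by blast
      \<comment> \<open>The errors add up to \<open>(2 * \<kappa> + 1) * \<rho> * s\<close>, which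
        is below \<open>\<epsilon> * s\<close> for this choice.\<close>
      define \<rho> where "\<rho> = \<epsilon> / (4 * (\<kappa> + 1))"
      have \<rho>: "\<rho> > 0" using \<epsilon>(1) IW(5) by (simp add: \<rho>_def)
      obtain v' where v': "rational_vec v'" "v' \<in> coord_space I" "norm (v' - ?p v) < \<rho>"
        using rational_approx_coord_space[OF coord_proj_in_coord_space \<rho>] by blast
      obtain \<delta>1 where \<delta>1: "\<delta>1 > 0" "\<And>s. 0 < s \<Longrightarrow> s < \<delta>1 \<Longrightarrow> \<exists>z\<in>Y. norm (z - g x - s *\<^sub>R v) \<le> \<rho> * s"
        using tan \<rho> unfolding tangent_at_def by meson
      obtain \<delta>2 where \<delta>2: "\<delta>2 > 0" "ball (g x) \<delta>2 \<subseteq> W" using IW(2) gx(2) by (rule openE)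
      define P where "P = norm v + \<rho>"
      have P: "P > 0" using \<rho> by (simp add: P_def add_nonneg_pos)
      define \<epsilon>' where "\<epsilon>' = min (min \<epsilon> \<delta>1) (\<delta>2 / P)"
      have \<epsilon>': "\<epsilon>' > 0" "\<epsilon>' \<le> \<epsilon>" "\<epsilon>' \<le> \<delta>1" "\<epsilon>' \<le> \<delta>2 / P"
        using \<epsilon>(1) \<delta>1(1) \<delta>2(1) P by (auto simp: \<epsilon>'_def)
      have "g (x + s *\<^sub>R v') \<notin> C l" if s: "0 < s" "s < \<epsilon>'" "x + s *\<^sub>R v' \<in> \<Omega>" for s
      proof
        assume inC: "g (x + s *\<^sub>R v') \<in> C l"
        define z where "z = g (x + s *\<^sub>R v')"
        have z: "z \<in> Y \<inter> W" "?p z = x + s *\<^sub>R v'" using g[OF s(3)] by (auto simp: z_def)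
        \<comment> \<open>An intermediary near \<open>g x + s *\<^sub>R v\<close>: it lies in
          \<open>Y \<inter> W\<close> like \<open>z\<close>, so the two can be compared through
          their projections.\<close>
        obtain z' where z': "z' \<in> Y" "norm (z' - g x - s *\<^sub>R v) \<le> \<rho> * s"
          using \<delta>1(2)[of s] s \<epsilon>'(3) by auto
        define e where "e = z' - g x - s *\<^sub>R v"
        have e: "norm e \<le> \<rho> * s" "z' = g x + s *\<^sub>R v + e" using z'(2) by (auto simp: e_def)
        have "norm (z' - g x) \<le> s * norm v + norm e"
          using norm_triangle_ineq[of "s *\<^sub>R v" e] s(1) by (simp add: e(2) add.assoc)
        also have "\<dots> \<le> s * P" using e(1) by (simp add: P_def algebra_simps)
        also have "\<dots> < \<delta>2"
        proof -
          have "s < \<delta>2 / P" using s(2) \<epsilon>'(4) by linarith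
          then show ?thesis using P by (simp only: pos_less_divide_eq)
        qed
        finally have "z' \<in> W" using \<delta>2(2) by (auto simp: dist_norm norm_minus_commute)
        have "?p (z - z') = s *\<^sub>R (v' - ?p v) - ?p e"
          using z(2) g(2)[OF x]
          by (simp add: e(2) linear_diff[OF linear_coord_proj] linear_add[OF linear_coord_proj]
              linear_scale[OF linear_coord_proj] scaleR_diff_right)
        then have "norm (?p (z - z')) \<le> s * norm (v' - ?p v) + norm (?p e)"
          using norm_triangle_ineq4[of "s *\<^sub>R (v' - ?p v)" "?p e"] s(1) by simp
        also have "\<dots> \<le> s * \<rho> + \<rho> * s"
          using norm_coord_proj_le[of I e] e(1) v'(3) s(1) by (intro add_mono mult_left_mono) auto
        finally have "norm (?p (z - z')) \<le> 2 * \<rho> * s" by simp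
        then have "\<kappa> * norm (?p (z - z')) \<le> \<kappa> * (2 * \<rho> * s)" using IW(5) by (intro mult_left_mono) auto
        then have zz: "norm (z - z') \<le> 2 * \<kappa> * \<rho> * s"
          using lower[OF z(1), of z'] z'(1) \<open>z' \<in> W\<close> by simp
        have "z - g x - s *\<^sub>R v = (z - z') + e" by (simp add: e_def)
        then have "norm (z - g x - s *\<^sub>R v) \<le> norm (z - z') + norm e" by (metis norm_triangle_ineq)
        also have "\<dots> \<le> (2 * \<kappa> + 1) * \<rho> * s" using zz e(1) by (simp add: algebra_simps)
        also have "\<dots> < \<epsilon> * s"
        proof -
          have "(2 * \<kappa> + 1) * \<rho> < (4 * (\<kappa> + 1)) * \<rho>" using IW(5) \<rho> by (intro mult_strict_right_mono) auto
          also have "\<dots> = \<epsilon>" using IW(5) by (simp add: \<rho>_def)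
          finally show ?thesis using s(1) by simp
        qed
        finally show False using \<epsilon>(2)[of s z] s \<epsilon>'(2) z(1) inC by (simp add: z_def)
      qed
      then show ?thesis using v'(1,2) \<epsilon>'(1) by blast
    qed
  qed
  then obtain u where u: "u \<in> \<Omega>" "g u \<in> UA f" "\<And>l. g u \<notin> C l" by blast
  have "g u \<notin> \<Union>\<C>" using u(3) rangeC by (metis UnionE imageE insertI2)
  then show ?thesis using g(1)[OF u(1)] u(2) IW(4) by blast
qed

text \<open>If the solutions were countable, their singletons could join the forbidden family and
  the construction would still find a solution. Density comes from running it inside a small
  ball.\<close>

lemma approximable_uncountable_dense:
  fixes Y :: "(real ^ 'n::finite) set"
  assumes Y: "analytic_submanifold d Y" "Y \<noteq> {}" "d > 0"
    and \<C>: "countable \<C>" "\<And>C. C \<in> \<C> \<Longrightarrow> closedin (top_of_set Y) C"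
      "\<And>C z. C \<in> \<C> \<Longrightarrow> z \<in> Y \<Longrightarrow> escapes Y C z"
    and f: "\<And>t. t > 0 \<Longrightarrow> f t > 0" "antimono_on {0<..} f"
      "filterlim (\<lambda>t. t powr (1 / (real CARD('n) - real d + 1)) * f t) at_top at_top"
  shows "uncountable (Y \<inter> UA f - \<Union>\<C>) \<and> Y \<subseteq> closure (Y \<inter> UA f - \<Union>\<C>)"
proof
  let ?G = "Y \<inter> UA f - \<Union>\<C>"
  show "uncountable ?G"
  proof
    assume "countable ?G"
    define \<D> where "\<D> = \<C> \<union> (\<lambda>z. {z}) ` ?G"
    obtain y where y: "y \<in> Y" using Y(2) by blast
    have "\<exists>z\<in>Y \<inter> UNIV. z \<in> UA f \<and> z \<notin> \<Union>\<D>"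
    proof (rule approximable_avoiding_escaped[OF Y(1) y open_UNIV UNIV_I _ _ _ f])
      show "countable \<D>" using \<C>(1) \<open>countable ?G\<close> by (simp add: \<D>_def)
      show "closedin (top_of_set Y) C" if "C \<in> \<D>" for C
        using that \<C>(2) by (auto simp: \<D>_def closedin_singleton)
      show "escapes Y C z" if "C \<in> \<D>" "z \<in> Y" for C z
        using that(1) unfolding \<D>_def
      proof
        assume "C \<in> \<C>"
        then show ?thesis using \<C>(3) that(2) by blast
      next
        assume "C \<in> (\<lambda>z. {z}) ` ?G"
        then obtain z0 where z0: "C = {z0}" "z0 \<in> Y" by blast
        show ?thesis
        proof (cases "z = z0")
          case True
          then show ?thesis using escapes_singleton[OF Y(1) that(2) Y(3)] z0 by simp
        next
          case False
          then show ?thesis using z0 that(2) by (intro escapes_outside_closed) (auto simp: closedin_singleton)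
        qed
      qed
    qed
    then show False by (auto simp: \<D>_def)
  qed
  show "Y \<subseteq> closure ?G"
  proof
    fix y assume y: "y \<in> Y"
    show "y \<in> closure ?G"
      unfolding closure_approachable
    proof (intro allI impI)
      fix e :: real assume "e > 0"
      then have "\<exists>z\<in>Y \<inter> ball y e. z \<in> UA f \<and> z \<notin> \<Union>\<C>"
        using \<C> by (intro approximable_avoiding_escaped[OF Y(1) y open_ball _ _ _ _ f]) auto
      then obtain z where "z \<in> ?G" "dist z y < e" by (auto simp: dist_commute)
      then show "\<exists>z\<in>?G. dist z y < e" by blast
    qed
  qed
qed

section \<open>The forbidden sets of the theorem: submanifolds and rational affine subspaces\<close>

lemma analytic_submanifold_openin:
  fixes Y :: "(real ^ 'n::finite) set"
  assumes "analytic_submanifold d Y" "analytic_submanifold k R" "R \<subseteq> Y" "d \<le> k"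
  shows "openin (top_of_set Y) R"
proof (subst openin_subopen, intro ballI)
  fix y assume y: "y \<in> R"
  then have yY: "y \<in> Y" using assms(3) by blast
  obtain U1 V1 \<phi>1 \<psi>1 L1 B1 A1 where "analytic_chart_at d Y y U1 V1 \<phi>1 \<psi>1 L1 B1 A1"
    using analytic_chart_exists[OF assms(1) yY] .
  note c1 = analytic_chart_atD[OF this]
  obtain U2 V2 \<phi>2 \<psi>2 L2 B2 A2 where "analytic_chart_at k R y U2 V2 \<phi>2 \<psi>2 L2 B2 A2"
    using analytic_chart_exists[OF assms(2) y] .
  note c2 = analytic_chart_atD[OF this]
  \<comment> \<open>\<open>\<phi>1 \<circ> \<psi>2\<close> maps this open piece of the slice of
    \<open>R\<close> injectively into the slice of \<open>Y\<close>, whose dimension is not larger.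
    By invariance of domain the image is open there, and its preimage is a neighbourhood of
    \<open>y\<close> in \<open>Y\<close> consisting of points of \<open>R\<close>.\<close>
  define S where "S = L2 \<inter> (V2 \<inter> \<psi>2 -` U1)"
  have "open (V2 \<inter> \<psi>2 -` U1)" using c2(3,20) c1(2) by (intro continuous_open_preimage)
  then have opS: "openin (top_of_set L2) S" unfolding S_def by (rule openin_open_Int)
  have SR: "\<psi>2 u \<in> R \<and> \<psi>2 u \<in> U1" if "u \<in> S" for u
    using that c2(8)[of "\<psi>2 u"] c2(17,18) by (auto simp: S_def)
  have "openin (top_of_set L1) ((\<phi>1 \<circ> \<psi>2) ` S)"
  proof (rule invariance_of_domain_subspaces[OF opS c2(6) c1(6)])
    show "dim L1 \<le> dim L2" using c1(7) c2(7) assms(4) by simp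
    show "continuous_on S (\<phi>1 \<circ> \<psi>2)"
      using continuous_on_subset[OF c2(20), of S] continuous_on_subset[OF c1(19), of "\<psi>2 ` S"] SR
      by (intro continuous_on_compose) (auto simp: S_def)
    show "\<phi>1 \<circ> \<psi>2 \<in> S \<rightarrow> L1"
    proof
      fix u assume "u \<in> S"
      then show "(\<phi>1 \<circ> \<psi>2) u \<in> L1" using SR[of u] c1(8)[of "\<psi>2 u"] assms(3) by auto
    qed
    show "inj_on (\<phi>1 \<circ> \<psi>2) S"
      using SR c1(15) c2(17) by (intro inj_on_inverseI[of _ "\<phi>2 \<circ> \<psi>1"]) (auto simp: S_def)
  qed
  then obtain G where G: "open G" "(\<phi>1 \<circ> \<psi>2) ` S = L1 \<inter> G" by (auto simp: openin_open)
  have "open (U1 \<inter> \<phi>1 -` G)" using c1(2,19) G(1) by (intro continuous_open_preimage)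
  then have "openin (top_of_set Y) (Y \<inter> (U1 \<inter> \<phi>1 -` G))" by (rule openin_open_Int)
  moreover have "y \<in> Y \<inter> (U1 \<inter> \<phi>1 -` G)"
  proof -
    have "\<phi>2 y \<in> S" using c2(1,15,16) c2(8)[of y] y c1(1) by (auto simp: S_def)
    then have "\<phi>1 y \<in> (\<phi>1 \<circ> \<psi>2) ` S" using c2(15)[OF c2(1)] by (auto intro!: image_eqI[of _ _ "\<phi>2 y"])
    then show ?thesis unfolding G(2) using yY c1(1) by blast
  qed
  moreover have "Y \<inter> (U1 \<inter> \<phi>1 -` G) \<subseteq> R"
  proof
    fix z assume z: "z \<in> Y \<inter> (U1 \<inter> \<phi>1 -` G)"
    then have "\<phi>1 z \<in> (\<phi>1 \<circ> \<psi>2) ` S" unfolding G(2) using c1(8) by blast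
    then obtain u where u: "u \<in> S" "\<phi>1 z = \<phi>1 (\<psi>2 u)" by auto
    then have "z = \<psi>2 u" using c1(15)[of z] c1(15)[of "\<psi>2 u"] SR[OF u(1)] z by auto
    then show "z \<in> R" using SR[OF u(1)] by simp
  qed
  ultimately show "\<exists>T. openin (top_of_set Y) T \<and> y \<in> T \<and> T \<subseteq> R" by blast
qed

lemma escapes_proper_closed_submanifold:
  fixes Y :: "(real ^ 'n::finite) set"
  assumes Y: "analytic_submanifold d Y" "connected Y" "z \<in> Y"
    and R: "proper_closed_analytic_submanifold_of R Y"
  shows "escapes Y R z"
proof (cases "z \<in> R")
  case False
  then show ?thesis
    using R Y(3) by (intro escapes_outside_closed) (auto simp: proper_closed_analytic_submanifold_of_def)
next
  case True
  obtain k where k: "R \<subset> Y" "closedin (top_of_set Y) R" "analytic_submanifold k R"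
    using R unfolding proper_closed_analytic_submanifold_of_def by blast
  have "k < d"
  proof (rule ccontr)
    assume "\<not> k < d"
    then have "openin (top_of_set Y) R"
      using k by (intro analytic_submanifold_openin[OF Y(1) k(3)]) auto
    then show False using Y(2) k(1,2) True unfolding connected_clopen by blast
  qed
  then show ?thesis using escapes_submanifold[OF Y(1) k(3) _ Y(3) True] by blast
qed

text \<open>The normal vector is the component of \<open>y - x\<close> orthogonal to the direction
  space of \<open>S\<close>.\<close>

lemma affine_subset_hyperplane:
  fixes S :: "'a::euclidean_space set"
  assumes "affine S" "S \<noteq> {}" "y \<notin> S"
  obtains a c where "S \<subseteq> {z. a \<bullet> z = c}" "a \<bullet> y \<noteq> c"
proof -
  obtain x where x: "x \<in> S" using assms(2) by blast
  define T where "T = (+) (- x) ` S"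
  have T: "subspace T" using assms(1) x affine_diffs_subspace[of S x] by (simp add: T_def)
  obtain u w where uw: "u \<in> span T" "\<And>t. t \<in> span T \<Longrightarrow> orthogonal w t" "y - x = u + w"
    using orthogonal_subspace_decomp_exists[of T "y - x"] by blast
  have spT: "span T = T" using T by (simp add: span_eq_iff)
  have "w \<noteq> 0"
  proof
    assume "w = 0"
    then have "y - x \<in> T" using uw(1,3) spT by simp
    then show False using assms(3) by (auto simp: T_def)
  qed
  show thesis
  proof (rule that[of w "w \<bullet> x"])
    show "S \<subseteq> {z. w \<bullet> z = w \<bullet> x}"
    proof
      fix z assume "z \<in> S"
      then have "- x + z \<in> T" by (simp add: T_def)
      then have "w \<bullet> (- x + z) = 0" using uw(2) spT by (simp add: orthogonal_def)
      then show "z \<in> {z. w \<bullet> z = w \<bullet> x}" by (simp add: inner_diff_right)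
    qed
    have "w \<bullet> (y - x) = w \<bullet> w" using uw by (simp add: inner_add_right orthogonal_def)
    then show "w \<bullet> y \<noteq> w \<bullet> x" using \<open>w \<noteq> 0\<close>
      by (metis eq_iff_diff_eq_0 inner_diff_right inner_eq_zero_iff)
  qed
qed

lemma closed_affine:
  fixes S :: "'a::euclidean_space set"
  assumes "affine S"
  shows "closed S"
  using closed_affine_hull[of S] assms by (simp add: hull_same)

text \<open>Enlarging \<open>S\<close> to a hyperplane that still misses a point of \<open>Y\<close>
  reduces this to the hyperplane case, as a vector that escapes a set also escapes its
  subsets.\<close>

lemma escapes_affine:
  fixes Y :: "(real ^ 'n::finite) set"
  assumes Y: "analytic_submanifold d Y" "connected Y" "z \<in> Y" and S: "affine S" "\<not> Y \<subseteq> S"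
  shows "escapes Y (Y \<inter> S) z"
proof (cases "z \<in> S")
  case False
  then show ?thesis using Y(3) S(1) by (intro escapes_outside_closed) (auto intro: closedin_closed_Int closed_affine)
next
  case True
  obtain y where "y \<in> Y" "y \<notin> S" using S(2) by blast
  then obtain a c where ac: "S \<subseteq> {z. a \<bullet> z = c}" "a \<bullet> y \<noteq> c"
    using affine_subset_hyperplane[OF S(1)] True by blast
  have "escapes Y {z. a \<bullet> z = c} z"
    using ac True \<open>y \<in> Y\<close> by (intro escapes_hyperplane[OF Y]) auto
  then show ?thesis using ac(1) by (rule_tac escapes_subset) auto
qed

text \<open>Any affine hull is already the hull of a finite affinely independent subset of its
  generators, so finite sets of rational points suffice.\<close>

lemma countable_rational_affine_subspaces:
  "countable {S :: (real ^ 'n::finite) set. rational_affine_subspace S}"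
proof (rule countable_subset)
  let ?Q = "{x :: real ^ 'n. rational_vec x}"
  have "countable ?Q"
  proof (rule countable_subset)
    show "?Q \<subseteq> (\<lambda>h. \<chi> i. h i) ` (\<Pi>\<^sub>E i\<in>UNIV. \<rat>)"
    proof
      fix x :: "real ^ 'n" assume "x \<in> ?Q"
      then show "x \<in> (\<lambda>h. \<chi> i. h i) ` (\<Pi>\<^sub>E i\<in>UNIV. \<rat>)"
        by (intro image_eqI[of _ _ "\<lambda>i. x $ i"]) (auto simp: rational_vec_def)
    qed
    show "countable ((\<lambda>h. \<chi> i. h i) ` (\<Pi>\<^sub>E i\<in>(UNIV::'n set). \<rat> :: real set))"
      by (intro countable_image countable_PiE countable_rat) auto
  qed
  then have "countable {B. finite B \<and> B \<subseteq> ?Q}" using countable_Collect_finite_subset by blast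
  then show "countable ((\<lambda>B. affine hull B) ` {B. finite B \<and> B \<subseteq> ?Q})" by (rule countable_image)
  show "{S. rational_affine_subspace S} \<subseteq> (\<lambda>B. affine hull B) ` {B. finite B \<and> B \<subseteq> ?Q}"
  proof
    fix S :: "(real ^ 'n) set" assume "S \<in> {S. rational_affine_subspace S}"
    then obtain X where X: "X \<subseteq> ?Q" "S = affine hull X"
      unfolding rational_affine_subspace_def rational_vec_def by auto
    obtain B where "B \<subseteq> X" "\<not> affine_dependent B" "affine hull X = affine hull B"
      using affine_basis_exists by blast
    then show "S \<in> (\<lambda>B. affine hull B) ` {B. finite B \<and> B \<subseteq> ?Q}"
      using X aff_independent_finite by blast
  qed
qed

theorem theorem7p2:
  fixes Y :: "(real ^ 'n::finite) set"
    and d :: nat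
    and R :: "nat \<Rightarrow> (real ^ 'n) set"
    and f :: "real \<Rightarrow> real"
  assumes "CARD('n) \<ge> 2"
    and "analytic_submanifold d Y" and "connected Y" and "Y \<noteq> {}" and "d \<ge> 2"
    and "\<And>l. proper_closed_analytic_submanifold_of (R l) Y"
    and "\<And>t. t > 0 \<Longrightarrow> f t > 0"
    and "continuous_on {0<..} f"
    and "antimono_on {0<..} f"
    and "\<exists>T>0. mono_on {T..} (\<lambda>t. t powr (1 / (real CARD('n) - real d + 1)) * f t)"
    and "filterlim (\<lambda>t. t powr (1 / (real CARD('n) - real d + 1)) * f t) at_top at_top"
  shows "(uncountable (Y \<inter> UA f - (\<Union>l. R l)) \<and> Y \<subseteq> closure (Y \<inter> UA f - (\<Union>l. R l))) \<and>
    ((\<forall>A. rational_affine_subspace A \<and> A \<noteq> UNIV \<longrightarrow> \<not> Y \<subseteq> A) \<longrightarrow>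
      uncountable (Y \<inter> UA_star f) \<and> Y \<subseteq> closure (Y \<inter> UA_star f))"
proof (intro conjI[OF _ impI])
  have d: "d > 0" using assms(5) by simp
  note main = approximable_uncountable_dense[OF assms(2,4) d _ _ _ assms(7,9,11)]
  show "uncountable (Y \<inter> UA f - (\<Union>l. R l)) \<and> Y \<subseteq> closure (Y \<inter> UA f - (\<Union>l. R l))"
  proof (rule main)
    show "closedin (top_of_set Y) C" if "C \<in> range R" for C
      using that assms(6) unfolding proper_closed_analytic_submanifold_of_def by blast
    show "escapes Y C z" if "C \<in> range R" "z \<in> Y" for C z
      using that escapes_proper_closed_submanifold[OF assms(2,3) _ assms(6)] by blast
  qed auto
  assume nc: "\<forall>A. rational_affine_subspace A \<and> A \<noteq> UNIV \<longrightarrow> \<not> Y \<subseteq> A"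
  \<comment> \<open>The trace of an affine subspace on \<open>Y\<close> need not be a submanifold,
    so the first part does not apply to this family; \<open>main\<close> asks only for relatively
    closed sets that \<open>Y\<close> escapes.\<close>
  define \<C> where "\<C> = (\<inter>) Y ` {S. rational_affine_subspace S \<and> S \<noteq> UNIV}"
  have aff: "affine S" if "rational_affine_subspace S" for S :: "(real ^ 'n) set"
    using that unfolding rational_affine_subspace_def by auto
  have "uncountable (Y \<inter> UA f - \<Union>\<C>) \<and> Y \<subseteq> closure (Y \<inter> UA f - \<Union>\<C>)"
  proof (rule main)
    show "countable \<C>" unfolding \<C>_def
      by (intro countable_image countable_subset[OF _ countable_rational_affine_subspaces]) auto
    show "closedin (top_of_set Y) C" if "C \<in> \<C>" for C
      using that aff unfolding \<C>_def by (auto intro: closedin_closed_Int closed_affine)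
    show "escapes Y C z" if "C \<in> \<C>" "z \<in> Y" for C z
      using that aff nc escapes_affine[OF assms(2,3) that(2)] unfolding \<C>_def by blast
  qed
  moreover have "Y \<inter> UA f - \<Union>\<C> = Y \<inter> UA_star f"
    unfolding \<C>_def UA_star_def by auto
  ultimately show "uncountable (Y \<inter> UA_star f) \<and> Y \<subseteq> closure (Y \<inter> UA_star f)" by simp
qed

end
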